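(* Let $X$ be a reflexive complex Banach space and let $T\in\mathcal{B}(X)$ be a power-bounded operator such that $\sigma(T)\cap\mathbb{T}\subseteq\{1\}$ and, for some $\alpha\ge 1$, $$\|R(e^{i\theta},T)\|=O(|\theta|^{-\alpha}),\quad \theta\to0.$$ Let $Z$ denote the closure of $\operatorname{Ran}(I-T)$. Then $X=\operatorname{Fix}T\oplus Z$, and, writing $P_T$ for the projection onto $\operatorname{Fix}T$ along $Z$, for all $x\in X$ we have $$\|T^nx-P_Tx\|\to0,\quad n\to\infty.\qquad( * )$$ Moreover: (i) if $\operatorname{Ran}(I-T)$ is closed, then there exist $C>0$ and $r\in[0,1)$ such that $\|T^n-P_T\|\le Cr^n$ for all $n\ge0$; (ii) if $\operatorname{Ran}(I-T)$ is not closed, then the convergence in $( * )$ is arbitrarily slow and weakly arbitrarily slow; (iii) in either case there exists a dense subspace $X_0$ of $X$ such that for all $x\in X_0$ the convergence in $( * )$ is superpolynomially fast.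
   Context: All Banach spaces are complex. $\mathcal{B}(X)$ is the algebra of bounded linear operators on $X$; $\operatorname{Ran}$ denotes range, $\operatorname{Ker}$ kernel, and $\operatorname{Fix}T=\operatorname{Ker}(I-T)$. $T$ is power-bounded if $\sup_{n\ge1}\|T^n\|<\infty$. $\mathbb{T}=\{\lambda\in\mathbb{C}:|\lambda|=1\}$, $\sigma(T)$ is the spectrum and $R(\lambda,T)=(\lambda I-T)^{-1}$ for $\lambda\in\mathbb{C}\setminus\sigma(T)$. Let $T_n\in\mathcal{B}(X)$, $n\ge0$, satisfy $\|T_nx\|\to0$ as $n\to\infty$ for all $x\in X$. The convergence is *arbitrarily slow* if for every sequence $(r_n)_{n\ge0}$ of non-negative scalars with $r_n\to0$ there exists $x\in X$ such that $\|T_nx\|\ge r_n$ for all $n\ge0$. It is *weakly arbitrarily slow* if for every such sequence $(r_n)_{n\ge0}$ there exist $x\in X$ and $\phi\in X^*$ such that $\operatorname{Re}\langle T_nx,\phi\rangle\ge r_n$ for all $n\ge0$, where $\langle x,\phi\rangle=\phi(x)$. It is *superpolynomially fast* for a particular $x\in X$ if $\|T_nx\|=o(n^{-k})$ as $n\to\infty$ for all $k\ge1$. For the convergence in $( * )$ these notions are applied with $T_n=T^n-P_T$. *)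

theory Defs
  imports "HOL-Analysis.Analysis" "HOL-Library.Landau_Symbols"
begin

section \<open>Complex Banach spaces\<close>

text \<open>The unit law for \<open>scaleC\<close> is the case \<open>r = 1\<close> of \<open>scaleC_of_real\<close>.\<close>

class complex_normed_vector = real_normed_vector +
  fixes scaleC :: "complex \<Rightarrow> 'a \<Rightarrow> 'a" (infixr "*\<^sub>C" 75)
  assumes scaleC_add_right: "c *\<^sub>C (x + y) = c *\<^sub>C x + c *\<^sub>C y"
    and scaleC_add_left: "(c + d) *\<^sub>C x = c *\<^sub>C x + d *\<^sub>C x"
    and scaleC_scaleC: "c *\<^sub>C (d *\<^sub>C x) = (c * d) *\<^sub>C x"
    and scaleC_of_real: "complex_of_real r *\<^sub>C x = r *\<^sub>R x"
    and norm_scaleC: "norm (c *\<^sub>C x) = cmod c * norm x"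

class complex_banach = complex_normed_vector + banach

instantiation complex :: complex_banach
begin

definition scaleC_complex :: "complex \<Rightarrow> complex \<Rightarrow> complex"
  where "scaleC_complex c x = c * x"

instance
  by standard
    (simp_all add: scaleC_complex_def algebra_simps norm_mult scaleR_conv_of_real)

end

definition csubspace :: "'a::complex_normed_vector set \<Rightarrow> bool"
  where "csubspace S \<longleftrightarrow>
    0 \<in> S \<and> (\<forall>x\<in>S. \<forall>y\<in>S. x + y \<in> S) \<and> (\<forall>c. \<forall>x\<in>S. c *\<^sub>C x \<in> S)"

definition direct_sum_decomposition ::
    "'a::complex_normed_vector set \<Rightarrow> 'a set \<Rightarrow> bool"
  where "direct_sum_decomposition M N \<longleftrightarrow>
    csubspace M \<and> csubspace N \<and> {u + v | u v. u \<in> M \<and> v \<in> N} = UNIV \<and> M \<inter> N = {0}"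


section \<open>Bounded complex-linear operators\<close>

definition bounded_clinear ::
    "('a::complex_normed_vector \<Rightarrow> 'b::complex_normed_vector) \<Rightarrow> bool"
  where "bounded_clinear f \<longleftrightarrow>
    bounded_linear f \<and> (\<forall>c x. f (c *\<^sub>C x) = c *\<^sub>C f x)"

typedef (overloaded) ('a, 'b) cblinfun ("(_ \<Rightarrow>\<^sub>C\<^sub>L /_)" [22, 21] 21) =
  "{f::'a::complex_normed_vector \<Rightarrow> 'b::complex_normed_vector. bounded_clinear f}"
  morphisms cblinfun_apply CBlinfun
proof
  have "c *\<^sub>C (0::'b) = 0" for c
    using norm_scaleC[of c "0::'b"] by simp
  then show "(\<lambda>x. 0) \<in> {f::'a \<Rightarrow> 'b. bounded_clinear f}"
    by (simp add: bounded_clinear_def)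
qed

notation cblinfun_apply (infixr "*\<^sub>V" 70)

setup_lifting type_definition_cblinfun

lemma scaleC_zero_right: "c *\<^sub>C (0::'a::complex_normed_vector) = 0"
  using norm_scaleC[of c "0::'a"] by simp

lemma scaleC_minus_right:
  "c *\<^sub>C (- x) = - (c *\<^sub>C (x::'a::complex_normed_vector))"
  using scaleC_add_right[of c x "- x"] scaleC_zero_right[of c, where 'a = 'a]
  by (metis add.right_inverse minus_unique)

lemma scaleC_diff_right:
  "c *\<^sub>C (x - y) = c *\<^sub>C x - c *\<^sub>C (y::'a::complex_normed_vector)"
  by (metis scaleC_add_right scaleC_minus_right diff_conv_add_uminus)

lemma bounded_linear_scaleC_right:
  "bounded_linear (\<lambda>x::'a::complex_normed_vector. c *\<^sub>C x)"
proof (rule bounded_linear_intro)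
  show "c *\<^sub>C (x + y) = c *\<^sub>C x + c *\<^sub>C y" for x y :: 'a
    by (rule scaleC_add_right)
  show "c *\<^sub>C (r *\<^sub>R x) = r *\<^sub>R (c *\<^sub>C x)" for r and x :: 'a
    by (simp add: scaleC_of_real[symmetric] scaleC_scaleC mult.commute)
  show "norm (c *\<^sub>C x) \<le> norm x * cmod c" for x :: 'a
    by (simp add: norm_scaleC)
qed

lemma onorm_scaleC:
  fixes f :: "'a::complex_normed_vector \<Rightarrow> 'b::complex_normed_vector"
  assumes "bounded_linear f"
  shows "onorm (\<lambda>x. c *\<^sub>C f x) = cmod c * onorm f"
proof -
  have "onorm (\<lambda>x. c *\<^sub>C f x) = onorm (\<lambda>x. cmod c *\<^sub>R f x)"
    by (simp add: onorm_def norm_scaleC)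
  then show ?thesis
    using onorm_scaleR[OF assms, of "cmod c"] by simp
qed

instantiation cblinfun :: (complex_normed_vector, complex_normed_vector) complex_normed_vector
begin

lift_definition norm_cblinfun :: "'a \<Rightarrow>\<^sub>C\<^sub>L 'b \<Rightarrow> real" is onorm .

lift_definition zero_cblinfun :: "'a \<Rightarrow>\<^sub>C\<^sub>L 'b" is "\<lambda>x. 0"
  by (simp add: bounded_clinear_def scaleC_zero_right)

lift_definition plus_cblinfun :: "'a \<Rightarrow>\<^sub>C\<^sub>L 'b \<Rightarrow> 'a \<Rightarrow>\<^sub>C\<^sub>L 'b \<Rightarrow> 'a \<Rightarrow>\<^sub>C\<^sub>L 'b"
  is "\<lambda>f g x. f x + g x"
  by (simp add: bounded_clinear_def scaleC_add_right bounded_linear_add)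

lift_definition minus_cblinfun :: "'a \<Rightarrow>\<^sub>C\<^sub>L 'b \<Rightarrow> 'a \<Rightarrow>\<^sub>C\<^sub>L 'b \<Rightarrow> 'a \<Rightarrow>\<^sub>C\<^sub>L 'b"
  is "\<lambda>f g x. f x - g x"
  by (simp add: bounded_clinear_def scaleC_diff_right bounded_linear_sub)

lift_definition uminus_cblinfun :: "'a \<Rightarrow>\<^sub>C\<^sub>L 'b \<Rightarrow> 'a \<Rightarrow>\<^sub>C\<^sub>L 'b" is "\<lambda>f x. - f x"
  by (simp add: bounded_clinear_def scaleC_minus_right bounded_linear_minus)

lift_definition scaleC_cblinfun :: "complex \<Rightarrow> 'a \<Rightarrow>\<^sub>C\<^sub>L 'b \<Rightarrow> 'a \<Rightarrow>\<^sub>C\<^sub>L 'b"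
  is "\<lambda>c f x. c *\<^sub>C f x"
  by (simp add: bounded_clinear_def scaleC_scaleC mult.commute
      bounded_linear_compose[OF bounded_linear_scaleC_right])

lift_definition scaleR_cblinfun :: "real \<Rightarrow> 'a \<Rightarrow>\<^sub>C\<^sub>L 'b \<Rightarrow> 'a \<Rightarrow>\<^sub>C\<^sub>L 'b"
  is "\<lambda>r f x. r *\<^sub>R f x"
  by (simp add: bounded_clinear_def scaleC_of_real[symmetric] scaleC_scaleC mult.commute
      bounded_linear_compose[OF bounded_linear_scaleC_right])

definition dist_cblinfun :: "'a \<Rightarrow>\<^sub>C\<^sub>L 'b \<Rightarrow> 'a \<Rightarrow>\<^sub>C\<^sub>L 'b \<Rightarrow> real"
  where "dist_cblinfun S T = norm (S - T)"

definition uniformity_cblinfun :: "(('a \<Rightarrow>\<^sub>C\<^sub>L 'b) \<times> ('a \<Rightarrow>\<^sub>C\<^sub>L 'b)) filter"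
  where "uniformity_cblinfun = (INF e\<in>{0 <..}. principal {(S, T). dist S T < e})"

definition open_cblinfun :: "('a \<Rightarrow>\<^sub>C\<^sub>L 'b) set \<Rightarrow> bool"
  where "open_cblinfun U = (\<forall>S\<in>U. \<forall>\<^sub>F (S', T) in uniformity. S' = S \<longrightarrow> T \<in> U)"

definition sgn_cblinfun :: "'a \<Rightarrow>\<^sub>C\<^sub>L 'b \<Rightarrow> 'a \<Rightarrow>\<^sub>C\<^sub>L 'b"
  where "sgn_cblinfun T = inverse (norm T) *\<^sub>R T"

instance
  apply standard
  unfolding dist_cblinfun_def open_cblinfun_def sgn_cblinfun_def uniformity_cblinfun_def
  apply (rule refl | (transfer, force simp: bounded_clinear_def onorm_triangle onorm_scaleR
        onorm_scaleC onorm_eq_0 algebra_simps scaleC_add_right scaleC_add_left scaleC_scaleC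
        scaleC_of_real))+
  done

end

lift_definition cblinfun_id :: "'a::complex_normed_vector \<Rightarrow>\<^sub>C\<^sub>L 'a" is "\<lambda>x. x"
  by (simp add: bounded_clinear_def)

lift_definition cblinfun_compose ::
    "'b::complex_normed_vector \<Rightarrow>\<^sub>C\<^sub>L 'c::complex_normed_vector \<Rightarrow>
     'a::complex_normed_vector \<Rightarrow>\<^sub>C\<^sub>L 'b \<Rightarrow> 'a \<Rightarrow>\<^sub>C\<^sub>L 'c" (infixl "o\<^sub>C\<^sub>L" 67)
  is "\<lambda>f g x. f (g x)"
  by (simp add: bounded_clinear_def bounded_linear_compose)

primrec cblinfun_power :: "'a::complex_normed_vector \<Rightarrow>\<^sub>C\<^sub>L 'a \<Rightarrow> nat \<Rightarrow> 'a \<Rightarrow>\<^sub>C\<^sub>L 'a" where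
  "cblinfun_power T 0 = cblinfun_id"
| "cblinfun_power T (Suc n) = T o\<^sub>C\<^sub>L cblinfun_power T n"

definition cblinfun_range ::
    "'a::complex_normed_vector \<Rightarrow>\<^sub>C\<^sub>L 'b::complex_normed_vector \<Rightarrow> 'b set"
  where "cblinfun_range T = range (cblinfun_apply T)"

definition cblinfun_kernel ::
    "'a::complex_normed_vector \<Rightarrow>\<^sub>C\<^sub>L 'b::complex_normed_vector \<Rightarrow> 'a set"
  where "cblinfun_kernel T = {x. T *\<^sub>V x = 0}"

definition Fix :: "'a::complex_normed_vector \<Rightarrow>\<^sub>C\<^sub>L 'a \<Rightarrow> 'a set"
  where "Fix T = cblinfun_kernel (cblinfun_id - T)"

definition is_projection_along ::
    "'a::complex_normed_vector \<Rightarrow>\<^sub>C\<^sub>L 'a \<Rightarrow> 'a set \<Rightarrow> 'a set \<Rightarrow> bool"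
  where "is_projection_along P M N \<longleftrightarrow>
    P o\<^sub>C\<^sub>L P = P \<and> cblinfun_range P = M \<and> cblinfun_kernel P = N"

definition power_bounded :: "'a::complex_normed_vector \<Rightarrow>\<^sub>C\<^sub>L 'a \<Rightarrow> bool"
  where "power_bounded T \<longleftrightarrow> bdd_above ((\<lambda>n. norm (cblinfun_power T n)) ` {1..})"


section \<open>Spectrum and resolvent\<close>

definition is_cblinfun_inverse ::
    "'a::complex_normed_vector \<Rightarrow>\<^sub>C\<^sub>L 'a \<Rightarrow> 'a \<Rightarrow>\<^sub>C\<^sub>L 'a \<Rightarrow> bool"
  where "is_cblinfun_inverse S R \<longleftrightarrow> S o\<^sub>C\<^sub>L R = cblinfun_id \<and> R o\<^sub>C\<^sub>L S = cblinfun_id"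

definition spectrum :: "'a::complex_normed_vector \<Rightarrow>\<^sub>C\<^sub>L 'a \<Rightarrow> complex set"
  where "spectrum T = {c. \<nexists>R. is_cblinfun_inverse (c *\<^sub>C cblinfun_id - T) R}"

text \<open>Only meaningful for scalars outside the spectrum, where the inverse exists and is unique.\<close>

definition resolvent ::
    "complex \<Rightarrow> 'a::complex_normed_vector \<Rightarrow>\<^sub>C\<^sub>L 'a \<Rightarrow> 'a \<Rightarrow>\<^sub>C\<^sub>L 'a"
  where "resolvent c T = (THE R. is_cblinfun_inverse (c *\<^sub>C cblinfun_id - T) R)"


section \<open>Reflexivity\<close>

lift_definition cbidual_embedding ::
    "'a::complex_normed_vector \<Rightarrow> ('a \<Rightarrow>\<^sub>C\<^sub>L complex) \<Rightarrow>\<^sub>C\<^sub>L complex"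
  is "\<lambda>x \<phi>. \<phi> *\<^sub>V x"
proof -
  fix x :: 'a
  have "bounded_linear (\<lambda>\<phi>::'a \<Rightarrow>\<^sub>C\<^sub>L complex. \<phi> *\<^sub>V x)"
  proof (rule bounded_linear_intro)
    show "(\<phi> + \<psi>) *\<^sub>V x = \<phi> *\<^sub>V x + \<psi> *\<^sub>V x" for \<phi> \<psi> :: "'a \<Rightarrow>\<^sub>C\<^sub>L complex"
      by transfer simp
    show "(r *\<^sub>R \<phi>) *\<^sub>V x = r *\<^sub>R (\<phi> *\<^sub>V x)" for r and \<phi> :: "'a \<Rightarrow>\<^sub>C\<^sub>L complex"
      by transfer simp
    show "norm (\<phi> *\<^sub>V x) \<le> norm \<phi> * norm x" for \<phi> :: "'a \<Rightarrow>\<^sub>C\<^sub>L complex"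
      by transfer (simp add: bounded_clinear_def onorm)
  qed
  moreover have "(c *\<^sub>C \<phi>) *\<^sub>V x = c *\<^sub>C (\<phi> *\<^sub>V x)" for c and \<phi> :: "'a \<Rightarrow>\<^sub>C\<^sub>L complex"
    by transfer simp
  ultimately show "bounded_clinear (\<lambda>\<phi>::'a \<Rightarrow>\<^sub>C\<^sub>L complex. \<phi> *\<^sub>V x)"
    by (simp add: bounded_clinear_def)
qed

definition reflexive_space :: "'a::complex_banach itself \<Rightarrow> bool"
  where "reflexive_space _ \<longleftrightarrow>
    surj (cbidual_embedding :: 'a \<Rightarrow> ('a \<Rightarrow>\<^sub>C\<^sub>L complex) \<Rightarrow>\<^sub>C\<^sub>L complex)"


section \<open>Rates of strong convergence to zero\<close>

definition arbitrarily_slow ::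
    "(nat \<Rightarrow> 'a::complex_normed_vector \<Rightarrow>\<^sub>C\<^sub>L 'a) \<Rightarrow> bool"
  where "arbitrarily_slow S \<longleftrightarrow>
    (\<forall>r::nat \<Rightarrow> real. (\<forall>n. 0 \<le> r n) \<and> r \<longlonglongrightarrow> 0 \<longrightarrow>
      (\<exists>x. \<forall>n. norm (S n *\<^sub>V x) \<ge> r n))"

definition weakly_arbitrarily_slow ::
    "(nat \<Rightarrow> 'a::complex_normed_vector \<Rightarrow>\<^sub>C\<^sub>L 'a) \<Rightarrow> bool"
  where "weakly_arbitrarily_slow S \<longleftrightarrow>
    (\<forall>r::nat \<Rightarrow> real. (\<forall>n. 0 \<le> r n) \<and> r \<longlonglongrightarrow> 0 \<longrightarrow>
      (\<exists>x. \<exists>\<phi>::'a \<Rightarrow>\<^sub>C\<^sub>L complex. \<forall>n. Re (\<phi> *\<^sub>V (S n *\<^sub>V x)) \<ge> r n))"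

definition superpolynomially_fast ::
    "(nat \<Rightarrow> 'a::complex_normed_vector \<Rightarrow>\<^sub>C\<^sub>L 'a) \<Rightarrow> 'a \<Rightarrow> bool"
  where "superpolynomially_fast S x \<longleftrightarrow>
    (\<forall>k::nat. k \<ge> 1 \<longrightarrow> (\<lambda>n. norm (S n *\<^sub>V x)) \<in> o(\<lambda>n. 1 / real n ^ k))"

end

theory Submission
  imports Defs
begin

text \<open>
  Write \<open>S = I - T\<close>. For large \<open>N\<close> the function \<open>(1 - z) ^ N R(z, T)\<close> is Lipschitz on the unit circle,
  so its Fourier coefficients are \<open>O(1/n)\<close>. Multiplication by \<open>T\<close> shifts the coefficients, up to those
  of the polynomial \<open>(1 - z) ^ N\<close>; since the coefficients tend to zero at \<open>-\<infinity>\<close> and \<open>T\<close> is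
  power-bounded, they vanish for very negative indices, and solving the recurrence upwards identifies
  them as multiples of \<open>T ^ n S ^ N\<close>. Hence \<open>T ^ n S ^ (k N) = O(n ^ (-k))\<close>.

  Reflexivity gives the mean ergodic decomposition, and \<open>S\<close> has dense range in \<open>Z\<close>, so by a
  Mittag-Leffler argument the common range of all powers of \<open>S\<close> is dense in \<open>Z\<close>; there the
  convergence is superpolynomial. If \<open>S\<close> has closed range, then every element of \<open>Z\<close> lies in the range
  of \<open>S ^ N\<close>, and uniform boundedness gives \<open>T ^ n - P \<rightarrow> 0\<close> in norm.

  If the range is not closed, there are unit vectors \<open>u = S w\<close> with \<open>S u\<close> arbitrarily small.
  Composing a norming functional of \<open>u\<close> with a Cesaro mean of \<open>T\<close> and with \<open>I - T ^ m\<close> yields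
  functionals \<open>\<phi> = \<psi> S\<close> of bounded norm with \<open>\<phi> S\<close> small and \<open>\<phi> (T ^ n u)\<close> close to \<open>1\<close> for a long
  time. The required vector and functional are \<open>\<Sum> q ^ k u k\<close> and \<open>\<Sum> q ^ k \<phi> k\<close> for a sequence of
  nearly biorthogonal such pairs: at each time at most one pair is in transition, and for \<open>q\<close> close
  to \<open>1\<close> its contribution is dominated by the pairs that have not yet moved.
\<close>

section \<open>Sublinear functionals and the Hahn--Banach theorem\<close>

definition sublinear :: "('a::real_vector \<Rightarrow> real) \<Rightarrow> bool"
  where "sublinear p \<longleftrightarrow>
    (\<forall>x y. p (x + y) \<le> p x + p y) \<and> (\<forall>t>0. \<forall>x. p (t *\<^sub>R x) \<le> t * p x)"

lemma sublinear_add: "sublinear p \<Longrightarrow> p (x + y) \<le> p x + p y"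
  by (simp add: sublinear_def)

lemma sublinear_zero:
  assumes "sublinear p"
  shows "p 0 = 0"
proof -
  have "p (2 *\<^sub>R 0) \<le> 2 * p 0" "p ((1/2) *\<^sub>R 0) \<le> (1/2) * p 0"
    using assms unfolding sublinear_def by (meson zero_less_numeral, meson half_gt_zero zero_less_one)
  then show ?thesis by simp
qed

lemma sublinear_scaleR:
  assumes "sublinear p" "t \<ge> 0"
  shows "p (t *\<^sub>R x) = t * p x"
proof (cases "t = 0")
  case True
  then show ?thesis using sublinear_zero[OF assms(1)] by simp
next
  case False
  then have t: "t > 0" using assms(2) by simp
  have "p (inverse t *\<^sub>R (t *\<^sub>R x)) \<le> inverse t * p (t *\<^sub>R x)"
    using assms(1) t unfolding sublinear_def by (meson positive_imp_inverse_positive)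
  then have "t * p x \<le> p (t *\<^sub>R x)" using t by (simp add: field_simps)
  moreover have "p (t *\<^sub>R x) \<le> t * p x" using assms(1) t by (simp add: sublinear_def)
  ultimately show ?thesis by simp
qed

lemma sublinear_minus:
  assumes "sublinear p"
  shows "- p (- x) \<le> p x"
  using sublinear_add[OF assms, of x "- x"] sublinear_zero[OF assms] by simp

text \<open>Making a sublinear functional as small as possible in the direction \<open>- y\<close>; a minimal
  sublinear functional is fixed by this for every \<open>y\<close>, hence additive.\<close>

definition tilt :: "('a::real_vector \<Rightarrow> real) \<Rightarrow> 'a \<Rightarrow> 'a \<Rightarrow> real"
  where "tilt q y x = (INF t\<in>{0..}. q (x + t *\<^sub>R y) - t * q y)"

lemma tilt_le:
  assumes "sublinear q" "t \<ge> 0"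
  shows "tilt q y x \<le> q (x + t *\<^sub>R y) - t * q y"
proof -
  have "- q (- x) \<le> q (x + t *\<^sub>R y) - t * q y" if "t \<ge> 0" for t
    using sublinear_add[OF assms(1), of "x + t *\<^sub>R y" "- x"] sublinear_scaleR[OF assms(1) that, of y]
    by simp
  then have "bdd_below ((\<lambda>t. q (x + t *\<^sub>R y) - t * q y) ` {0..})"
    by (intro bdd_belowI[of _ "- q (- x)"]) auto
  then show ?thesis unfolding tilt_def using assms(2) by (intro cINF_lower) auto
qed

lemma tilt_greatest:
  "(\<And>t. t \<ge> 0 \<Longrightarrow> c \<le> q (x + t *\<^sub>R y) - t * q y) \<Longrightarrow> c \<le> tilt q y x"
  unfolding tilt_def by (intro cINF_greatest) auto

lemma sublinear_tilt:
  assumes "sublinear q"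
  shows "sublinear (tilt q y)"
  unfolding sublinear_def
proof (intro conjI allI impI)
  fix x z
  have *: "tilt q y (x + z) \<le> (q (x + s *\<^sub>R y) - s * q y) + (q (z + t *\<^sub>R y) - t * q y)"
    if "s \<ge> 0" "t \<ge> 0" for s t
    using tilt_le[OF assms, of "s + t" y "x + z"] that
      sublinear_add[OF assms, of "x + s *\<^sub>R y" "z + t *\<^sub>R y"]
    by (simp add: algebra_simps)
  have "tilt q y (x + z) - (q (x + s *\<^sub>R y) - s * q y) \<le> tilt q y z" if "s \<ge> 0" for s
    by (rule tilt_greatest) (use *[OF that] in \<open>simp add: algebra_simps\<close>)
  then have "tilt q y (x + z) - tilt q y z \<le> tilt q y x"
    by (intro tilt_greatest) (simp add: algebra_simps)
  then show "tilt q y (x + z) \<le> tilt q y x + tilt q y z" by simp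
next
  fix a :: real and x
  assume a: "a > 0"
  have "tilt q y (a *\<^sub>R x) / a \<le> tilt q y x"
  proof (rule tilt_greatest)
    fix t :: real assume t: "t \<ge> 0"
    have "tilt q y (a *\<^sub>R x) \<le> q (a *\<^sub>R (x + t *\<^sub>R y)) - a * t * q y"
      using tilt_le[OF assms, of "a * t" y "a *\<^sub>R x"] a t by (simp add: algebra_simps)
    also have "\<dots> = a * (q (x + t *\<^sub>R y) - t * q y)"
      using sublinear_scaleR[OF assms, of a "x + t *\<^sub>R y"] a by (simp add: algebra_simps)
    finally show "tilt q y (a *\<^sub>R x) / a \<le> q (x + t *\<^sub>R y) - t * q y"
      using a by (simp add: field_simps)
  qed
  then show "tilt q y (a *\<^sub>R x) \<le> a * tilt q y x" using a by (simp add: field_simps)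
qed

lemma tilt_le_self: "sublinear q \<Longrightarrow> tilt q y x \<le> q x"
  using tilt_le[of q 0 y x] by simp

lemma minimal_sublinear_exists:
  assumes p: "sublinear p"
  shows "\<exists>q. sublinear q \<and> (\<forall>x. q x \<le> p x) \<and>
    (\<forall>q'. sublinear q' \<longrightarrow> (\<forall>x. q' x \<le> q x) \<longrightarrow> q' = q)"
proof -
  define A where "A = {q. sublinear q \<and> (\<forall>x. q x \<le> p x)}"
  define R where "R = relation_of (\<lambda>q r. r \<le> q) A"
  have "\<exists>m\<in>A. \<forall>a\<in>A. a \<le> m \<longrightarrow> a = m"
  proof (rule predicate_Zorn[where P = "\<lambda>q r. r \<le> q"])
    show "partial_order_on A (relation_of (\<lambda>q r. r \<le> q) A)"
      by (rule partial_order_on_relation_ofI) auto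
    fix C assume C: "C \<in> Chains (relation_of (\<lambda>q r. r \<le> q) A)"
    show "\<exists>u\<in>A. \<forall>a\<in>C. u \<le> a"
    proof (cases "C = {}")
      case True
      then show ?thesis using p by (auto simp: A_def)
    next
      case False
      have CA: "q \<in> A" if "q \<in> C" for q
        using C that by (auto simp: Chains_def relation_of_def)
      have Cc: "q \<le> r \<or> r \<le> q" if "q \<in> C" "r \<in> C" for q r
        using C that by (auto simp: Chains_def relation_of_def)
      define u where "u x = (INF q\<in>C. q x)" for x
      have "- p (- x) \<le> q x" if "q \<in> C" for q x
        using CA[OF that] sublinear_minus[of q x] unfolding A_def
        by (smt (verit) mem_Collect_eq)
      then have bdd: "bdd_below ((\<lambda>q. q x) ` C)" for x
        by (intro bdd_belowI[of _ "- p (- x)"]) auto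
      have ule: "u x \<le> q x" if "q \<in> C" for q x
        unfolding u_def using bdd that by (intro cINF_lower) auto
      have ugr: "c \<le> u x" if "\<And>q. q \<in> C \<Longrightarrow> c \<le> q x" for c x
        unfolding u_def using False that by (intro cINF_greatest) auto
      have "sublinear u"
        unfolding sublinear_def
      proof (intro conjI allI impI)
        fix x y
        have *: "u (x + y) \<le> q x + r y" if qr: "q \<in> C" "r \<in> C" for q r
        proof -
          obtain s where s: "s \<in> C" "s \<le> q" "s \<le> r" using Cc[OF qr] qr by auto
          have "u (x + y) \<le> s x + s y"
            using ule[OF s(1), of "x + y"] CA[OF s(1)] sublinear_add[of s x y] by (auto simp: A_def)
          also have "\<dots> \<le> q x + r y" using s(2,3) by (intro add_mono) (auto simp: le_fun_def)
          finally show ?thesis .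
        qed
        have "u (x + y) - q x \<le> u y" if "q \<in> C" for q
          by (rule ugr) (use *[OF that] in \<open>simp add: algebra_simps\<close>)
        then have "u (x + y) - u y \<le> u x"
          by (intro ugr) (simp add: algebra_simps)
        then show "u (x + y) \<le> u x + u y" by simp
      next
        fix t :: real and x assume t: "t > 0"
        have "u (t *\<^sub>R x) / t \<le> u x"
        proof (rule ugr)
          fix q assume q: "q \<in> C"
          have "u (t *\<^sub>R x) \<le> t * q x"
            using ule[OF q, of "t *\<^sub>R x"] CA[OF q] t by (auto simp: A_def sublinear_scaleR)
          then show "u (t *\<^sub>R x) / t \<le> q x" using t by (simp add: field_simps)
        qed
        then show "u (t *\<^sub>R x) \<le> t * u x" using t by (simp add: field_simps)
      qed
      moreover obtain q0 where "q0 \<in> C" using False by auto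
      ultimately have "u \<in> A" using ule[of q0] CA[of q0] order_trans unfolding A_def by blast
      then show ?thesis using ule by (auto simp: le_fun_def)
    qed
  qed
  then obtain q where q: "q \<in> A" "\<And>a. a \<in> A \<Longrightarrow> a \<le> q \<Longrightarrow> a = q" by blast
  show ?thesis
  proof (intro exI conjI allI impI)
    show "sublinear q" and "q x \<le> p x" for x using q(1) by (auto simp: A_def)
    fix q' assume q': "sublinear q'" "\<forall>x. q' x \<le> q x"
    have "q' x \<le> p x" for x
      using q'(2) q(1) by (auto simp: A_def intro: order_trans[of _ "q x"])
    then show "q' = q" using q(2)[of q'] q' by (auto simp: A_def le_fun_def)
  qed
qed

theorem real_Hahn_Banach:
  assumes p: "sublinear p"
  shows "\<exists>f. linear f \<and> (\<forall>x. f x \<le> p x) \<and> f y = p y"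
proof -
  obtain f where f: "sublinear f" "\<And>x. f x \<le> tilt p y x"
    and min: "\<And>q. sublinear q \<Longrightarrow> (\<And>x. q x \<le> f x) \<Longrightarrow> q = f"
    using minimal_sublinear_exists[OF sublinear_tilt[OF p, of y]] by blast
  have tilt: "tilt f z = f" for z
    using min[OF sublinear_tilt[OF f(1), of z]] tilt_le_self[OF f(1)] by blast
  have add: "f (x + z) = f x + f z" for x z
    using tilt_le[OF f(1), of 1 z x] sublinear_add[OF f(1), of x z] by (simp add: tilt)
  have neg: "f (- x) = - f x" for x
    using add[of x "- x"] sublinear_zero[OF f(1)] by simp
  have "f (c *\<^sub>R x) = c * f x" for c x
  proof (cases "c \<ge> 0")
    case True
    then show ?thesis by (rule sublinear_scaleR[OF f(1)])
  next
    case False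
    then have "f ((- c) *\<^sub>R x) = (- c) * f x" by (intro sublinear_scaleR[OF f(1)]) simp
    then show ?thesis using neg[of "c *\<^sub>R x"] by simp
  qed
  then have "linear f" by (intro linearI) (auto simp: add)
  moreover have fp: "f x \<le> p x" for x
    using f(2)[of x] tilt_le_self[OF p, of y x] by simp
  moreover have "p y \<le> f y"
    using f(2)[of "- y"] tilt_le[OF p, of 1 y "- y"] sublinear_zero[OF p] neg[of y] by simp
  ultimately show ?thesis by (metis order_antisym)
qed

lemma scaleC_zero_left: "0 *\<^sub>C x = (0::'a::complex_normed_vector)"
  using scaleC_of_real[of 0 x] by simp

lemma scaleC_one: "1 *\<^sub>C x = (x::'a::complex_normed_vector)"
  using scaleC_of_real[of 1 x] by simp

lemma scaleC_minus_left: "(- c) *\<^sub>C x = - (c *\<^sub>C (x::'a::complex_normed_vector))"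
  using scaleC_add_left[of c "- c" x] by (simp add: scaleC_zero_left eq_neg_iff_add_eq_0 add.commute)

lemma scaleC_diff_left: "(c - d) *\<^sub>C x = c *\<^sub>C x - d *\<^sub>C (x::'a::complex_normed_vector)"
  using scaleC_add_left[of c "- d" x] by (simp add: scaleC_minus_left)

lemma scaleR_scaleC: "r *\<^sub>R (c *\<^sub>C x) = c *\<^sub>C (r *\<^sub>R (x::'a::complex_normed_vector))"
  by (simp add: scaleC_of_real[symmetric] scaleC_scaleC mult.commute)

lemma bounded_clinearI:
  assumes "\<And>x y. f (x + y) = f x + f y" and "\<And>c x. f (c *\<^sub>C x) = c *\<^sub>C f x"
    and "\<And>x. norm (f x) \<le> K * norm x"
  shows "bounded_clinear f"
  unfolding bounded_clinear_def
proof
  show "bounded_linear f"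
    by (rule bounded_linear_intro[where K = K])
       (use assms in \<open>auto simp: scaleC_of_real[symmetric] mult.commute\<close>)
qed (use assms in auto)

theorem complex_Hahn_Banach:
  fixes p :: "'a::complex_normed_vector \<Rightarrow> real"
  assumes add: "\<And>x y. p (x + y) \<le> p x + p y" and hom: "\<And>c x. p (c *\<^sub>C x) = cmod c * p x"
    and bd: "\<And>x. p x \<le> norm x"
  shows "\<exists>\<psi>::'a \<Rightarrow> complex. bounded_clinear \<psi> \<and> (\<forall>x. cmod (\<psi> x) \<le> p x) \<and> \<psi> y = p y"
proof -
  have "sublinear p"
    unfolding sublinear_def using add hom[of "complex_of_real _"] by (simp add: scaleC_of_real)
  then obtain f where f: "linear f" "\<And>x. f x \<le> p x" "f y = p y"
    using real_Hahn_Banach[of p y] by blast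
  define \<psi> where "\<psi> x = Complex (f x) (- f (\<i> *\<^sub>C x))" for x
  have \<psi>_add: "\<psi> (x + z) = \<psi> x + \<psi> z" for x z
    using linear_add[OF f(1)] by (simp add: \<psi>_def scaleC_add_right complex_eq_iff)
  have \<psi>_hom: "\<psi> (c *\<^sub>C x) = c * \<psi> x" for c x
  proof -
    have *: "f (c *\<^sub>C x) = Re c * f x + Im c * f (\<i> *\<^sub>C x)" for c x
    proof -
      have "c *\<^sub>C x = (complex_of_real (Re c) + complex_of_real (Im c) * \<i>) *\<^sub>C x"
        using complex_eq[of c] by (simp add: mult.commute)
      also have "\<dots> = Re c *\<^sub>R x + Im c *\<^sub>R (\<i> *\<^sub>C x)"
        by (simp only: scaleC_add_left scaleC_scaleC[symmetric] scaleC_of_real)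
      finally show ?thesis by (simp add: linear_add[OF f(1)] linear_scale[OF f(1)])
    qed
    show ?thesis
      using *[of c x] *[of "\<i> * c" x]
      by (simp add: \<psi>_def scaleC_scaleC complex_eq_iff algebra_simps)
  qed
  have \<psi>_le: "cmod (\<psi> x) \<le> p x" for x
  proof (cases "\<psi> x = 0")
    case True
    have "0 \<le> p x" using add[of x "- x"] hom[of "-1" x] hom[of 0 x]
      by (simp add: scaleC_zero_left scaleC_one scaleC_minus_left)
    then show ?thesis using True by simp
  next
    case False
    define c where "c = cnj (\<psi> x) / cmod (\<psi> x)"
    have c1: "cmod c = 1" using False by (simp add: c_def norm_divide)
    have "cnj (\<psi> x) * \<psi> x = (complex_of_real (cmod (\<psi> x)))\<^sup>2"
      using complex_norm_square[of "\<psi> x"] by (simp add: mult.commute)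
    then have "c * \<psi> x = cmod (\<psi> x)"
      using False by (simp add: c_def power2_eq_square)
    then have "cmod (\<psi> x) = Re (\<psi> (c *\<^sub>C x))" by (simp add: \<psi>_hom)
    also have "\<dots> \<le> p (c *\<^sub>C x)" using f(2) by (simp add: \<psi>_def)
    finally show ?thesis by (simp add: hom c1)
  qed
  have "bounded_clinear \<psi>"
    by (rule bounded_clinearI[where K = 1])
       (use \<psi>_add \<psi>_hom order_trans[OF \<psi>_le bd] in \<open>auto simp: scaleC_complex_def\<close>)
  moreover have "\<psi> y = p y"
  proof -
    have "Re (\<psi> y) = p y" using f(3) by (simp add: \<psi>_def)
    moreover have "(Re (\<psi> y))\<^sup>2 + (Im (\<psi> y))\<^sup>2 \<le> (p y)\<^sup>2"
      using power_mono[OF \<psi>_le[of y] norm_ge_zero, of 2] by (simp add: cmod_power2)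
    ultimately have "Im (\<psi> y) = 0" by simp
    then show ?thesis using \<open>Re (\<psi> y) = p y\<close> by (simp add: complex_eq_iff)
  qed
  ultimately show ?thesis using \<psi>_le by blast
qed

corollary norming_functional:
  "\<exists>\<psi>::'a::complex_normed_vector \<Rightarrow> complex.
    bounded_clinear \<psi> \<and> (\<forall>x. cmod (\<psi> x) \<le> norm x) \<and> \<psi> y = norm y"
  by (rule complex_Hahn_Banach) (auto simp: norm_triangle_ineq norm_scaleC)

lemma infdist_subspace_hom:
  fixes Z :: "'a::complex_normed_vector set"
  assumes Z: "csubspace Z"
  shows "infdist (c *\<^sub>C x) Z = cmod c * infdist x Z"
proof -
  have Z0: "0 \<in> Z" and Zc: "\<And>c x. x \<in> Z \<Longrightarrow> c *\<^sub>C x \<in> Z" using Z by (auto simp: csubspace_def)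
  have ne: "Z \<noteq> {}" using Z0 by auto
  have le: "infdist (c *\<^sub>C x) Z \<le> cmod c * infdist x Z" if "c \<noteq> 0" for c x
  proof -
    have "infdist (c *\<^sub>C x) Z / cmod c \<le> infdist x Z"
      unfolding infdist_notempty[OF ne, of x]
    proof (rule cINF_greatest[OF ne])
      fix z assume "z \<in> Z"
      then have "infdist (c *\<^sub>C x) Z \<le> dist (c *\<^sub>C x) (c *\<^sub>C z)" by (intro infdist_le Zc)
      also have "\<dots> = cmod c * dist x z"
        by (simp add: dist_norm scaleC_diff_right[symmetric] norm_scaleC)
      finally show "infdist (c *\<^sub>C x) Z / cmod c \<le> dist x z"
        using that by (simp add: field_simps)
    qed
    then show ?thesis using that by (simp add: field_simps)
  qed
  show ?thesis
  proof (cases "c = 0")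
    case True
    then show ?thesis using Z0 by (simp add: scaleC_zero_left)
  next
    case False
    have "infdist (inverse c *\<^sub>C c *\<^sub>C x) Z \<le> cmod (inverse c) * infdist (c *\<^sub>C x) Z"
      using False by (intro le) simp
    then have "cmod c * infdist x Z \<le> infdist (c *\<^sub>C x) Z"
      using False by (simp add: scaleC_scaleC scaleC_one norm_divide field_simps)
    then show ?thesis using le[OF False, of x] by simp
  qed
qed

corollary separating_functional:
  fixes Z :: "'a::complex_normed_vector set"
  assumes Z: "csubspace Z" "closed Z" and y: "y \<notin> Z"
  shows "\<exists>\<psi>::'a \<Rightarrow> complex. bounded_clinear \<psi> \<and> (\<forall>z\<in>Z. \<psi> z = 0) \<and> \<psi> y \<noteq> 0"
proof -
  have Z0: "0 \<in> Z" and Zadd: "\<And>x y. x \<in> Z \<Longrightarrow> y \<in> Z \<Longrightarrow> x + y \<in> Z"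
    using Z by (auto simp: csubspace_def)
  have ne: "Z \<noteq> {}" using Z0 by auto
  have tri: "infdist (x + y) Z \<le> infdist x Z + infdist y Z" for x y
  proof -
    have *: "infdist (x + y) Z \<le> dist x z + dist y w" if "z \<in> Z" "w \<in> Z" for z w
      using infdist_le[OF Zadd[OF that], of "x + y"] norm_triangle_ineq[of "x - z" "y - w"]
      by (simp add: dist_norm algebra_simps)
    have "infdist (x + y) Z - dist x z \<le> infdist y Z" if "z \<in> Z" for z
      unfolding infdist_notempty[OF ne, of y]
      by (rule cINF_greatest[OF ne]) (use *[OF that] in \<open>simp add: algebra_simps\<close>)
    then have "infdist (x + y) Z - infdist y Z \<le> infdist x Z"
      unfolding infdist_notempty[OF ne, of x]
      by (intro cINF_greatest[OF ne]) (simp add: algebra_simps)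
    then show ?thesis by simp
  qed
  obtain \<psi> :: "'a \<Rightarrow> complex" where \<psi>: "bounded_clinear \<psi>" "\<And>x. cmod (\<psi> x) \<le> infdist x Z"
    "\<psi> y = infdist y Z"
    using complex_Hahn_Banach[of "\<lambda>x. infdist x Z" y, OF tri infdist_subspace_hom[OF Z(1)]]
      infdist_le[OF Z0] by auto
  have "infdist y Z > 0" using infdist_pos_not_in_closed[OF Z(2) ne y] .
  moreover have "\<psi> z = 0" if "z \<in> Z" for z using \<psi>(2)[of z] that by simp
  ultimately show ?thesis using \<psi>(1,3) by (metis less_irrefl of_real_eq_0_iff)
qed

section \<open>Consequences of completeness\<close>

lemma geometric_steps_converge:
  fixes x :: "nat \<Rightarrow> 'a::banach"
  assumes step: "\<And>k. norm (x (Suc k) - x k) \<le> c * q ^ k" and q: "0 \<le> q" "q < 1"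
  shows "\<exists>l. x \<longlonglongrightarrow> l \<and> (\<forall>n. norm (l - x n) \<le> c * q ^ n / (1 - q))"
proof -
  define d where "d k = x (Suc k) - x k" for k
  have sumq: "summable (\<lambda>k. c * q ^ (k + n))" for n
    using q by (intro summable_mult) (simp add: power_add summable_mult2 summable_geometric)
  have sumd: "summable (\<lambda>k. d (k + n))" for n
    by (rule summable_comparison_test'[OF sumq[of n], of 0]) (use step in \<open>auto simp: d_def\<close>)
  have xn: "x n = x 0 + (\<Sum>k<n. d k)" for n by (induction n) (auto simp: d_def)
  define l where "l = x 0 + suminf d"
  have "(\<lambda>n. x 0 + (\<Sum>k<n. d k)) \<longlonglongrightarrow> l"
    unfolding l_def using sumd[of 0] by (intro tendsto_intros summable_LIMSEQ) simp
  moreover have "(\<lambda>n. x 0 + (\<Sum>k<n. d k)) = x" by (rule ext) (rule xn[symmetric])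
  ultimately have "x \<longlonglongrightarrow> l" by simp
  moreover have "norm (l - x n) \<le> c * q ^ n / (1 - q)" for n
  proof -
    have "l - x n = (\<Sum>k. d (k + n))"
      unfolding l_def xn[of n] using suminf_split_initial_segment[of d n] sumd[of 0] by simp
    also have "norm \<dots> \<le> (\<Sum>k. c * q ^ (k + n))"
      using step by (intro norm_suminf_le sumq) (simp add: d_def)
    also have "\<dots> = (\<Sum>k. (c * q ^ n) * q ^ k)" by (simp add: power_add mult_ac)
    also have "\<dots> = c * q ^ n / (1 - q)"
      using q by (subst suminf_mult) (auto simp: summable_geometric suminf_geometric)
    finally show ?thesis .
  qed
  ultimately show ?thesis by blast
qed

text \<open>Sokal's observation: the two values \<open>f (x + \<xi>)\<close> and \<open>f (x - \<xi>)\<close> differ by \<open>2 f \<xi>\<close>.\<close>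

lemma ball_value_large:
  assumes f: "bounded_linear f" and r: "r > 0"
  shows "\<exists>y. norm (y - x) \<le> r \<and> norm (f y) \<ge> 2/3 * r * onorm f"
proof (cases "onorm f = 0")
  case True
  then show ?thesis using r by (intro exI[of _ x]) simp
next
  case False
  then have pos: "onorm f > 0" using onorm_pos_le[OF f] by simp
  have "\<exists>z. norm (f z) > 2/3 * onorm f * norm z"
  proof (rule ccontr)
    assume "\<nexists>z. norm (f z) > 2/3 * onorm f * norm z"
    then have "onorm f \<le> 2/3 * onorm f"
      using pos by (intro onorm_bound) (auto simp: not_less)
    then show False using pos by simp
  qed
  then obtain z where z: "norm (f z) > 2/3 * onorm f * norm z" by blast
  interpret f: bounded_linear f by (rule f)
  have z0: "norm z > 0" using z f.zero by fastforce
  define \<xi> where "\<xi> = (r / norm z) *\<^sub>R z"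
  have n\<xi>: "norm \<xi> = r" using z0 r by (simp add: \<xi>_def)
  have "norm (f \<xi>) = r / norm z * norm (f z)" using r by (simp add: \<xi>_def f.scaleR)
  also have "\<dots> \<ge> r / norm z * (2/3 * onorm f * norm z)" using z z0 r by (intro mult_left_mono) auto
  also have "r / norm z * (2/3 * onorm f * norm z) = 2/3 * r * onorm f" using z0 by simp
  finally have f\<xi>: "norm (f \<xi>) \<ge> 2/3 * r * onorm f" .
  have "2 *\<^sub>R f \<xi> = f (x + \<xi>) - f (x - \<xi>)" by (simp add: f.add f.diff scaleR_2)
  then have "2 * norm (f \<xi>) \<le> norm (f (x + \<xi>)) + norm (f (x - \<xi>))"
    by (metis norm_scaleR abs_numeral norm_triangle_ineq4)
  then consider "norm (f (x + \<xi>)) \<ge> norm (f \<xi>)" | "norm (f (x - \<xi>)) \<ge> norm (f \<xi>)" by linarith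
  then show ?thesis
  proof cases
    case 1
    then show ?thesis using f\<xi> n\<xi> by (intro exI[of _ "x + \<xi>"]) auto
  next
    case 2
    then show ?thesis using f\<xi> n\<xi> by (intro exI[of _ "x - \<xi>"]) auto
  qed
qed

theorem uniform_boundedness:
  fixes f :: "'i \<Rightarrow> 'a::banach \<Rightarrow> 'b::real_normed_vector"
  assumes f: "\<And>i. bounded_linear (f i)" and pt: "\<And>x. \<exists>B. \<forall>i. norm (f i x) \<le> B"
  shows "\<exists>K. \<forall>i x. norm (f i x) \<le> K * norm x"
proof (rule ccontr)
  assume contra: "\<nexists>K. \<forall>i x. norm (f i x) \<le> K * norm x"
  have "\<exists>i. onorm (f i) > K" for K
  proof (rule ccontr)
    assume "\<nexists>i. onorm (f i) > K"
    then have "norm (f i x) \<le> K * norm x" for i x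
      using onorm[OF f, of i x] mult_right_mono[of "onorm (f i)" K "norm x"]
      by (meson norm_ge_zero not_less order_trans)
    then show False using contra by blast
  qed
  then have "\<forall>k::nat. \<exists>i. onorm (f i) > 4 ^ k" by blast
  then obtain \<tau> where \<tau>: "\<And>k. onorm (f (\<tau> k)) > 4 ^ k" by metis
  define Q where "Q n x y \<longleftrightarrow> norm (y - x) \<le> (1/3) ^ Suc n \<and>
    norm (f (\<tau> (Suc n)) y) \<ge> 2/3 * (1/3) ^ Suc n * onorm (f (\<tau> (Suc n)))" for n and x y :: 'a
  have "\<exists>x. \<forall>n. True \<and> Q n (x n) (x (Suc n))"
  proof (rule dependent_nat_choice[where P = "\<lambda>_ _. True"])
    show "\<exists>y. True \<and> Q n x y" for n x
      unfolding Q_def using ball_value_large[OF f, of "(1/3) ^ Suc n" x "\<tau> (Suc n)"] by simp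
  qed simp
  then obtain x where x: "\<And>n. Q n (x n) (x (Suc n))" by blast
  then have "norm (x (Suc k) - x k) \<le> (1/3) * (1/3) ^ k" for k
    unfolding Q_def by simp
  from geometric_steps_converge[OF this]
  obtain l where l: "\<And>n. norm (l - x n) \<le> (1/3) * (1/3) ^ n / (1 - 1/3)" by auto
  obtain B where B: "\<And>i. norm (f i l) \<le> B" using pt by blast
  have large: "(1/6) * (4/3) ^ Suc n \<le> B" for n
  proof -
    let ?g = "f (\<tau> (Suc n))"
    interpret g: bounded_linear ?g by (rule f)
    have "norm (?g (l - x (Suc n))) \<le> onorm ?g * ((1/2) * (1/3) ^ Suc n)"
      by (rule order_trans[OF onorm[OF f] mult_left_mono[OF _ onorm_pos_le[OF f]]])
         (use l[of "Suc n"] in simp)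
    moreover have "norm (?g (x (Suc n))) \<le> norm (?g l) + norm (?g (l - x (Suc n)))"
      using norm_triangle_sub[of "?g (x (Suc n))" "?g l"]
      by (simp add: g.diff norm_minus_commute)
    moreover have "norm (?g (x (Suc n))) \<ge> 2/3 * (1/3) ^ Suc n * onorm ?g"
      using x[of n] by (simp add: Q_def)
    ultimately have "(1/6) * (1/3) ^ Suc n * onorm ?g \<le> B"
      using B[of "\<tau> (Suc n)"] by (simp add: algebra_simps)
    moreover have "(1/6) * (1/3) ^ Suc n * (4::real) ^ Suc n \<le> (1/6) * (1/3) ^ Suc n * onorm ?g"
      using \<tau>[of "Suc n"] by (intro mult_left_mono) auto
    ultimately show ?thesis by (simp add: power_divide)
  qed
  obtain n where n: "6 * B < (4/3::real) ^ n" using real_arch_pow[of "4/3" "6 * B"] by auto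
  have "(4/3::real) ^ n \<le> (4/3) ^ Suc n" by simp
  then show False using n large[of n] by argo
qed

text \<open>The Mittag-Leffler argument: perturbing \<open>z\<close> so that it has a compatible chain of preimages
  \<open>z = S y\<^sub>1, y\<^sub>1 = S y\<^sub>2, \<dots>\<close>.\<close>

theorem dense_range_all_powers:
  fixes S :: "'a::banach \<Rightarrow> 'a"
  assumes S: "bounded_linear S"
    and dense: "\<And>z e. z \<in> Z \<Longrightarrow> e > 0 \<Longrightarrow> \<exists>w\<in>Z. norm (S w - z) < e"
    and z: "z \<in> Z" and e: "e > 0"
  shows "\<exists>y. norm (y - z) < e \<and> (\<forall>k. \<exists>w. y = (S ^^ k) w)"
proof -
  interpret S: bounded_linear S by (rule S)
  obtain K where K: "\<And>x. norm (S x) \<le> norm x * K" using S.bounded by blast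
  define L where "L = max 1 K"
  have L1: "L \<ge> 1" by (simp add: L_def)
  have L: "norm (S x) \<le> L * norm x" for x
    using K[of x] mult_left_mono[of K L "norm x"] by (simp add: L_def mult.commute)
  have Lk: "norm ((S ^^ k) x) \<le> L ^ k * norm x" for k x
  proof (induction k)
    case (Suc k)
    have "norm (S ((S ^^ k) x)) \<le> L * (L ^ k * norm x)"
      using L[of "(S ^^ k) x"] mult_left_mono[OF Suc, of L] L1 by linarith
    then show ?case by (simp add: mult_ac)
  qed simp
  have diffk: "(S ^^ k) (x - y) = (S ^^ k) x - (S ^^ k) y" for k x y
    by (induction k) (auto simp: S.diff)
  define Q where "Q n x y \<longleftrightarrow> norm (S y - x) < e / (4 * 2 ^ n * L ^ n)" for n and x y :: 'a
  have "\<exists>x. \<forall>n. (x n \<in> Z \<and> (n = 0 \<longrightarrow> x n = z)) \<and> Q n (x n) (x (Suc n))"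
  proof (rule dependent_nat_choice[where P = "\<lambda>n x. x \<in> Z \<and> (n = 0 \<longrightarrow> x = z)"])
    fix x and n :: nat assume "x \<in> Z \<and> (n = 0 \<longrightarrow> x = z)"
    moreover have "e / (4 * 2 ^ n * L ^ n) > 0" using e L1 by simp
    ultimately show "\<exists>y. (y \<in> Z \<and> (Suc n = 0 \<longrightarrow> y = z)) \<and> Q n x y"
      unfolding Q_def using dense[of x "e / (4 * 2 ^ n * L ^ n)"] by auto
  qed (use z in auto)
  then obtain x where x: "x 0 = z" "\<And>n. Q n (x n) (x (Suc n))" by blast
  have "norm ((S ^^ Suc k) (x (j + Suc k)) - (S ^^ k) (x (j + k))) \<le> (e / 4) * (1/2) ^ k" for j k
  proof -
    have "norm ((S ^^ k) (S (x (j + Suc k)) - x (j + k)))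
        \<le> L ^ k * (e / (4 * 2 ^ (j + k) * L ^ (j + k)))"
      by (rule order_trans[OF Lk mult_left_mono])
         (use x(2)[of "j + k"] L1 in \<open>auto simp: Q_def\<close>)
    also have "\<dots> = (e / 4) * (1/2) ^ k * (1 / (2 ^ j * L ^ j))"
      using L1 by (simp add: power_add power_divide)
    also have "\<dots> \<le> (e / 4) * (1/2) ^ k * 1"
      using L1 e mult_mono[of 1 "2 ^ j" 1 "L ^ j"]
      by (intro mult_left_mono) (auto simp: divide_le_eq one_le_power)
    finally show ?thesis by (simp add: diffk funpow_swap1)
  qed
  then have "\<exists>l. (\<lambda>k. (S ^^ k) (x (j + k))) \<longlonglongrightarrow> l \<and>
      (\<forall>n. norm (l - (S ^^ n) (x (j + n))) \<le> (e / 4) * (1/2) ^ n / (1 - 1/2))" for j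
    by (intro geometric_steps_converge) auto
  then obtain y where y: "\<And>j. (\<lambda>k. (S ^^ k) (x (j + k))) \<longlonglongrightarrow> y j"
    and y0: "\<And>j n. norm (y j - (S ^^ n) (x (j + n))) \<le> (e / 4) * (1/2) ^ n / (1 - 1/2)" by metis
  have Sy: "S (y (Suc j)) = y j" for j
  proof -
    have "(\<lambda>k. S ((S ^^ k) (x (Suc j + k)))) \<longlonglongrightarrow> S (y (Suc j))" by (intro S.tendsto y)
    moreover have "(\<lambda>k. (S ^^ Suc k) (x (j + Suc k))) \<longlonglongrightarrow> y j"
      using LIMSEQ_Suc[OF y[of j]] .
    ultimately show ?thesis using LIMSEQ_unique by fastforce
  qed
  have "y 0 = (S ^^ k) (y k)" for k
    by (induction k) (auto simp: Sy funpow_swap1 simp del: funpow.simps(2) simp add: funpow_Suc_right)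
  moreover have "norm (y 0 - z) < e" using y0[of 0 0] x(1) e by simp
  ultimately show ?thesis by blast
qed

section \<open>Power-bounded maps and their Cesaro means\<close>

locale power_bounded_map =
  fixes T :: "'a::complex_banach \<Rightarrow> 'a" and M :: real
  assumes clin: "bounded_clinear T" and M1: "M \<ge> 1"
    and pow_norm: "norm ((T ^^ n) x) \<le> M * norm x"
begin

lemma bl_T: "bounded_linear T"
  using clin by (simp add: bounded_clinear_def)

lemma pow_add: "(T ^^ n) (x + y) = (T ^^ n) x + (T ^^ n) y"
  by (induction n) (auto simp: linear_add[OF bounded_linear.linear[OF bl_T]])

lemma pow_diff: "(T ^^ n) (x - y) = (T ^^ n) x - (T ^^ n) y"
  by (induction n) (auto simp: linear_diff[OF bounded_linear.linear[OF bl_T]])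

lemma pow_scaleC: "(T ^^ n) (c *\<^sub>C x) = c *\<^sub>C (T ^^ n) x"
  using clin by (induction n) (auto simp: bounded_clinear_def)

lemma pow_zero: "(T ^^ n) 0 = 0"
  using pow_diff[of n 0 0] by simp

lemma pow_clin: "bounded_clinear (T ^^ n)"
  by (rule bounded_clinearI[where K = M]) (auto simp: pow_add pow_scaleC pow_norm)

lemma pow_pow: "(T ^^ m) ((T ^^ n) x) = (T ^^ (m + n)) x"
  by (simp add: funpow_add)

lemma pow_fixed: "T x = x \<Longrightarrow> (T ^^ n) x = x"
  by (induction n) auto

lemmas T_add = pow_add[of 1, simplified] and T_diff = pow_diff[of 1, simplified]
  and T_scaleC = pow_scaleC[of 1, simplified] and T_zero = pow_zero[of 1, simplified]
  and T_norm = pow_norm[of 1, simplified]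

definition S :: "'a \<Rightarrow> 'a" where "S x = x - T x"

definition Z :: "'a set" where "Z = closure (range S)"

definition psum :: "nat \<Rightarrow> 'a \<Rightarrow> 'a" where "psum n x = (\<Sum>i<n. (T ^^ i) x)"

definition cesaro :: "nat \<Rightarrow> 'a \<Rightarrow> 'a" where "cesaro n x = (1 / real n) *\<^sub>R psum n x"

lemma S_add: "S (x + y) = S x + S y" by (simp add: S_def T_add)
lemma S_diff: "S (x - y) = S x - S y" by (simp add: S_def T_diff)
lemma S_scaleC: "S (c *\<^sub>C x) = c *\<^sub>C S x" by (simp add: S_def T_scaleC scaleC_diff_right)
lemma S_zero: "S 0 = 0" by (simp add: S_def T_zero)

lemma S_norm: "norm (S x) \<le> (1 + M) * norm x"
  using norm_triangle_ineq4[of x "T x"] T_norm[of x] by (simp add: S_def algebra_simps)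

lemma S_clin: "bounded_clinear S"
  by (rule bounded_clinearI[where K = "1 + M"]) (auto simp: S_add S_scaleC S_norm)

lemma bl_S: "bounded_linear S"
  using S_clin by (simp add: bounded_clinear_def)

lemma S_pow: "(T ^^ n) (S x) = S ((T ^^ n) x)"
  by (simp add: S_def pow_diff funpow_swap1)

lemma Spow_add: "(S ^^ n) (x + y) = (S ^^ n) x + (S ^^ n) y"
  by (induction n) (auto simp: S_add)

lemma Spow_scaleC: "(S ^^ n) (c *\<^sub>C x) = c *\<^sub>C (S ^^ n) x"
  by (induction n) (auto simp: S_scaleC)

lemma Spow_zero: "(S ^^ n) 0 = 0"
  by (induction n) (auto simp: S_zero)

lemma Spow_pow: "(T ^^ n) ((S ^^ k) x) = (S ^^ k) ((T ^^ n) x)"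
  by (induction k) (auto simp: S_pow)

lemma S_eq_0_iff: "S x = 0 \<longleftrightarrow> T x = x" by (auto simp: S_def)

lemma psum_add: "psum n (x + y) = psum n x + psum n y"
  by (simp add: psum_def pow_add sum.distrib)

lemma psum_diff: "psum n (x - y) = psum n x - psum n y"
  by (simp add: psum_def pow_diff sum_subtractf)

lemma psum_scaleC: "psum n (c *\<^sub>C x) = c *\<^sub>C psum n x"
  by (induction n) (auto simp: psum_def pow_scaleC scaleC_add_right scaleC_zero_right)

lemma psum_S: "psum n (S x) = x - (T ^^ n) x"
  by (induction n) (auto simp: psum_def S_def pow_diff funpow_swap1)

lemma S_psum: "S (psum n x) = psum n (S x)"
  by (induction n) (auto simp: psum_def S_add S_zero S_pow)

lemma psum_norm: "norm (psum n x) \<le> real n * (M * norm x)"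
  unfolding psum_def by (rule order_trans[OF norm_sum sum_bounded_above[THEN order_trans]])
    (auto simp: pow_norm)

lemma pow_orbit_diff: "norm ((T ^^ n) x - x) \<le> real n * (M * norm (S x))"
  using psum_norm[of n "S x"] by (simp add: psum_S norm_minus_commute)

lemma cesaro_add: "cesaro n (x + y) = cesaro n x + cesaro n y"
  by (simp add: cesaro_def psum_add scaleR_add_right)

lemma cesaro_diff: "cesaro n (x - y) = cesaro n x - cesaro n y"
  by (simp add: cesaro_def psum_diff scaleR_diff_right)

lemma cesaro_scaleC: "cesaro n (c *\<^sub>C x) = c *\<^sub>C cesaro n x"
  by (simp add: cesaro_def psum_scaleC scaleR_scaleC[symmetric] scaleC_of_real[symmetric] scaleC_scaleC mult.commute)

lemma cesaro_norm: "norm (cesaro n x) \<le> M * norm x"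
proof (cases "n = 0")
  case False
  then show ?thesis using psum_norm[of n x] by (simp add: cesaro_def field_simps)
qed (use M1 in \<open>simp add: cesaro_def psum_def\<close>)

lemma S_cesaro: "S (cesaro n x) = cesaro n (S x)"
  using linear_scale[OF bounded_linear.linear[OF bl_S]] by (simp add: cesaro_def S_psum)

lemma cesaro_S_norm: "norm (cesaro n (S x)) \<le> (1 + M) * norm x / real n"
proof -
  have "norm (x - (T ^^ n) x) \<le> (1 + M) * norm x"
    using norm_triangle_ineq4[of x "(T ^^ n) x"] pow_norm[of n x] by (simp add: algebra_simps)
  then show ?thesis by (simp add: cesaro_def psum_S divide_right_mono)
qed

lemma cesaro_fixed: "T x = x \<Longrightarrow> n > 0 \<Longrightarrow> cesaro n x = x"
  by (simp add: cesaro_def psum_def pow_fixed scaleR_conv_of_real)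
     (simp add: sum_constant_scaleR)

lemma csubspace_Z: "csubspace Z"
  unfolding csubspace_def
proof (intro conjI ballI allI)
  show "0 \<in> Z" unfolding Z_def by (metis S_zero closure_subset rangeI subsetD)
  fix x y assume "x \<in> Z" "y \<in> Z"
  then obtain f g where "\<And>n. f n \<in> range S" "f \<longlonglongrightarrow> x" "\<And>n. g n \<in> range S" "g \<longlonglongrightarrow> y"
    unfolding Z_def closure_sequential by blast
  moreover from this have "f n + g n \<in> range S" for n
  proof -
    obtain v w where "f n = S v" "g n = S w" using \<open>f n \<in> range S\<close> \<open>g n \<in> range S\<close> by blast
    then show ?thesis by (simp add: S_add[symmetric])
  qed
  ultimately show "x + y \<in> Z"
    unfolding Z_def closure_sequential by (intro exI[of _ "\<lambda>n. f n + g n"]) (auto intro: tendsto_add)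
next
  fix c x assume "x \<in> Z"
  then obtain f where "\<And>n. f n \<in> range S" "f \<longlonglongrightarrow> x" unfolding Z_def closure_sequential by blast
  moreover from this have "c *\<^sub>C f n \<in> range S" for n
  proof -
    obtain w where "f n = S w" using \<open>f n \<in> range S\<close> by blast
    then show ?thesis by (simp add: S_scaleC[symmetric])
  qed
  ultimately show "c *\<^sub>C x \<in> Z"
    unfolding Z_def closure_sequential
    by (intro exI[of _ "\<lambda>n. c *\<^sub>C f n"]) (auto intro: bounded_linear.tendsto[OF bounded_linear_scaleC_right])
qed

lemma closed_Z: "closed Z" by (simp add: Z_def)
lemma S_in_Z: "S x \<in> Z" unfolding Z_def using closure_subset[of "range S"] by blast

lemma Z_approx: "z \<in> Z \<Longrightarrow> e > 0 \<Longrightarrow> \<exists>w. norm (S w - z) < e"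
  unfolding Z_def closure_approachable by (auto simp: dist_norm)

lemma cesaro_Z:
  assumes "z \<in> Z"
  shows "(\<lambda>n. cesaro n z) \<longlonglongrightarrow> 0"
proof (rule LIMSEQ_I)
  fix e :: real assume e: "e > 0"
  obtain w where w: "norm (S w - z) < e / (2 * M)"
    using Z_approx[OF assms, of "e / (2 * M)"] e M1 by auto
  obtain N where N: "real N > 2 * (1 + M) * norm w / e" using reals_Archimedean2 by blast
  show "\<exists>no. \<forall>n\<ge>no. norm (cesaro n z - 0) < e"
  proof (intro exI[of _ "Suc N"] allI impI)
    fix n assume n: "n \<ge> Suc N"
    have "(1 + M) * norm w / real n < e / 2"
      using N n e by (simp add: field_simps) (smt (verit) mult_left_mono of_nat_mono of_nat_Suc)
    moreover have "norm (cesaro n (S w - z)) \<le> e / 2"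
      using order_trans[OF cesaro_norm mult_left_mono[OF less_imp_le[OF w]]] M1 by simp
    ultimately show "norm (cesaro n z - 0) < e"
      using cesaro_S_norm[of n w] norm_triangle_ineq4[of "cesaro n (S w)" "cesaro n (S w - z)"]
      by (simp only: cesaro_diff diff_diff_eq2 add_diff_cancel_left' diff_zero)
  qed
qed

lemma fixed_in_Z: "x \<in> Z \<Longrightarrow> T x = x \<Longrightarrow> x = 0"
proof -
  assume x: "x \<in> Z" "T x = x"
  have "\<forall>\<^sub>F n in sequentially. cesaro n x = x"
    using eventually_gt_at_top[of 0] by eventually_elim (rule cesaro_fixed[OF x(2)])
  then have "(\<lambda>n. cesaro n x) \<longlonglongrightarrow> x" by (rule tendsto_eventually)
  then show "x = 0" using cesaro_Z[OF x(1)] by (rule LIMSEQ_unique)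
qed

end

section \<open>Weak cluster points and the mean ergodic theorem\<close>

lemma cblinfun_norm_apply: "norm (f *\<^sub>V x) \<le> norm f * norm x"
  by transfer (simp add: bounded_clinear_def onorm)

lemma cblinfun_norm_bound: "0 \<le> K \<Longrightarrow> (\<And>x. norm (f *\<^sub>V x) \<le> K * norm x) \<Longrightarrow> norm f \<le> K"
  by transfer (rule onorm_bound)

lemma CBlinfun_apply: "bounded_clinear f \<Longrightarrow> CBlinfun f *\<^sub>V x = f x"
  by (simp add: CBlinfun_inverse)

lemma cblinfun_bounded_clinear: "bounded_clinear (cblinfun_apply f)"
  using cblinfun_apply by auto

lemma cblinfun_bounded_linear: "bounded_linear (cblinfun_apply f)"
  using cblinfun_bounded_clinear[of f] by (simp add: bounded_clinear_def)

lemma bounded_clinear_compose: "bounded_clinear f \<Longrightarrow> bounded_clinear g \<Longrightarrow> bounded_clinear (\<lambda>x. f (g x))"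
  by (simp add: bounded_clinear_def bounded_linear_compose)

lemma reflexive_spaceD:
  assumes "reflexive_space TYPE('a::complex_banach)"
    and \<Phi>: "bounded_clinear (\<Phi> :: ('a \<Rightarrow>\<^sub>C\<^sub>L complex) \<Rightarrow> complex)"
  shows "\<exists>y. \<forall>\<phi>. \<Phi> \<phi> = \<phi> *\<^sub>V y"
proof -
  obtain y where "CBlinfun \<Phi> = cbidual_embedding y"
    using assms(1) unfolding reflexive_space_def surj_def by blast
  then have "\<Phi> \<phi> = \<phi> *\<^sub>V y" for \<phi>
    using CBlinfun_apply[OF \<Phi>, of \<phi>] by (simp add: cbidual_embedding.rep_eq)
  then show ?thesis by blast
qed

lemma bounded_sequence_weak_cluster_point:
  fixes a :: "nat \<Rightarrow> 'a::complex_banach"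
  assumes refl: "reflexive_space TYPE('a)" and B: "\<And>n. norm (a n) \<le> B"
  shows "\<exists>y. \<forall>\<phi>::'a \<Rightarrow>\<^sub>C\<^sub>L complex. \<forall>N. \<forall>e>0. \<exists>n\<ge>N. cmod (\<phi> *\<^sub>V a n - \<phi> *\<^sub>V y) < e"
proof -
  define ev where "ev n \<phi> = \<phi> *\<^sub>V a n" for n and \<phi> :: "'a \<Rightarrow>\<^sub>C\<^sub>L complex"
  define K where "K = PiE (UNIV :: ('a \<Rightarrow>\<^sub>C\<^sub>L complex) set) (\<lambda>\<phi>. cball (0::complex) (norm \<phi> * B))"
  have "compactin (product_topology (\<lambda>_. euclidean) UNIV) K"
    unfolding K_def compactin_PiE by simp
  then have K: "compact K" by (simp add: euclidean_product_topology)
  have evK: "ev n \<in> K" for n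
    unfolding K_def ev_def
    using order_trans[OF cblinfun_norm_apply mult_left_mono[OF B norm_ge_zero]] by (auto simp: PiE_iff)
  have "K \<inter> (\<Inter>n. closure (ev ` {n..})) \<noteq> {}"
  proof (rule compact_imp_fip_image[OF K])
    fix I :: "nat set" assume "finite I"
    then obtain m where "\<And>i. i \<in> I \<Longrightarrow> i \<le> m" using finite_nat_set_iff_bounded_le by auto
    then have "ev m \<in> closure (ev ` {i..})" if "i \<in> I" for i
      using closure_subset[of "ev ` {i..}"] that by auto
    then show "K \<inter> (\<Inter>i\<in>I. closure (ev ` {i..})) \<noteq> {}" using evK[of m] by blast
  qed auto
  then obtain \<Phi> where \<Phi>: "\<And>n. \<Phi> \<in> closure (ev ` {n..})" and "\<Phi> \<in> K" by blast
  have closedD: "\<Phi> \<in> D" if "closed D" "\<And>n. ev n \<in> D" for D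
    using closure_minimal[of "ev ` {0..}" D] \<Phi>[of 0] that by blast
  have "\<Phi> \<in> {f. f (\<phi> + \<psi>) = f \<phi> + f \<psi>}" for \<phi> \<psi>
  proof (rule closedD)
    show "closed {f :: _ \<Rightarrow> complex. f (\<phi> + \<psi>) = f \<phi> + f \<psi>}"
      by (intro closed_Collect_eq continuous_on_add continuous_on_product_coordinates)
  qed (simp add: ev_def plus_cblinfun.rep_eq)
  moreover have "\<Phi> \<in> {f. f (c *\<^sub>C \<phi>) = c * f \<phi>}" for c \<phi>
  proof (rule closedD)
    show "closed {f. f (c *\<^sub>C \<phi>) = c * f \<phi>}"
      by (intro closed_Collect_eq continuous_on_mult continuous_on_const continuous_on_product_coordinates)
  qed (simp add: ev_def scaleC_cblinfun.rep_eq scaleC_complex_def)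
  moreover have "cmod (\<Phi> \<phi>) \<le> B * norm \<phi>" for \<phi>
    using \<open>\<Phi> \<in> K\<close> by (simp add: K_def PiE_iff mult.commute)
  ultimately have "bounded_clinear \<Phi>"
    by (intro bounded_clinearI[where K = B]) (auto simp: scaleC_complex_def)
  then obtain y where y: "\<And>\<phi>. \<Phi> \<phi> = \<phi> *\<^sub>V y" using reflexive_spaceD[OF refl] by blast
  have "\<exists>n\<ge>N. cmod (\<phi> *\<^sub>V a n - \<phi> *\<^sub>V y) < e" if e: "e > 0" for \<phi> N e
  proof -
    have "open {f. cmod (f \<phi> - \<Phi> \<phi>) < e}"
      by (intro open_Collect_less continuous_intros) auto
    moreover have "\<Phi> \<in> {f. cmod (f \<phi> - \<Phi> \<phi>) < e}" using e by simp
    ultimately have "{f. cmod (f \<phi> - \<Phi> \<phi>) < e} \<inter> ev ` {N..} \<noteq> {}"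
      using \<Phi>[of N] open_Int_closure_eq_empty by blast
    then show ?thesis by (auto simp: ev_def y)
  qed
  then show ?thesis by blast
qed

lemma functionals_separate:
  fixes x :: "'a::complex_normed_vector"
  assumes "\<And>\<phi>::'a \<Rightarrow>\<^sub>C\<^sub>L complex. \<phi> *\<^sub>V x = 0"
  shows "x = 0"
proof -
  obtain \<psi> :: "'a \<Rightarrow> complex" where "bounded_clinear \<psi>" "\<psi> x = norm x"
    using norming_functional[of x] by blast
  then show ?thesis using assms[of "CBlinfun \<psi>"] by (simp add: CBlinfun_apply)
qed

context power_bounded_map
begin

theorem mean_ergodic:
  assumes refl: "reflexive_space TYPE('a)"
  shows "\<exists>y. T y = y \<and> x - y \<in> Z"
proof -
  obtain y where y: "\<And>\<phi>::'a \<Rightarrow>\<^sub>C\<^sub>L complex. \<And>N e. e > 0 \<Longrightarrow>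
      \<exists>n\<ge>N. cmod (\<phi> *\<^sub>V cesaro n x - \<phi> *\<^sub>V y) < e"
    using bounded_sequence_weak_cluster_point[OF refl, of "\<lambda>n. cesaro n x", OF cesaro_norm] by blast
  have "S y = 0"
  proof (rule functionals_separate)
    fix \<phi> :: "'a \<Rightarrow>\<^sub>C\<^sub>L complex"
    define \<psi> where "\<psi> = CBlinfun (\<lambda>x. \<phi> *\<^sub>V S x)"
    have \<psi>: "\<psi> *\<^sub>V v = \<phi> *\<^sub>V S v" for v
      unfolding \<psi>_def
      by (rule CBlinfun_apply[OF bounded_clinear_compose[OF cblinfun_bounded_clinear S_clin]])
    have "norm (\<phi> *\<^sub>V S y) \<le> e" if e: "e > 0" for e
    proof -
      have "(\<lambda>n. cesaro n (S x)) \<longlonglongrightarrow> 0" by (rule cesaro_Z[OF S_in_Z])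
      then have "(\<lambda>n. \<phi> *\<^sub>V cesaro n (S x)) \<longlonglongrightarrow> \<phi> *\<^sub>V 0"
        by (rule bounded_linear.tendsto[OF cblinfun_bounded_linear])
      then have "(\<lambda>n. \<phi> *\<^sub>V S (cesaro n x)) \<longlonglongrightarrow> 0"
        by (simp add: S_cesaro linear_0[OF bounded_linear.linear[OF cblinfun_bounded_linear]])
      then obtain N where N: "\<And>n. n \<ge> N \<Longrightarrow> cmod (\<phi> *\<^sub>V S (cesaro n x)) < e / 2"
        using LIMSEQ_D[of _ 0 "e / 2"] e by auto
      obtain n where "n \<ge> N" "cmod (\<phi> *\<^sub>V S (cesaro n x) - \<phi> *\<^sub>V S y) < e / 2"
        using y[of "e / 2" N \<psi>] e by (auto simp: \<psi>)
      then show ?thesis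
        using N[of n] norm_triangle_sub[of "\<phi> *\<^sub>V S y" "\<phi> *\<^sub>V S (cesaro n x)"]
        by (simp add: norm_minus_commute)
    qed
    then have "norm (\<phi> *\<^sub>V S y) \<le> 0" by (rule field_le_epsilon[of _ 0, simplified])
    then show "\<phi> *\<^sub>V S y = 0" by simp
  qed
  moreover have "x - y \<in> Z"
  proof (rule ccontr)
    assume "x - y \<notin> Z"
    then obtain \<psi> :: "'a \<Rightarrow> complex" where \<psi>: "bounded_clinear \<psi>" "\<And>z. z \<in> Z \<Longrightarrow> \<psi> z = 0"
      and ne: "\<psi> (x - y) \<noteq> 0"
      using separating_functional[OF csubspace_Z closed_Z] by blast
    interpret bounded_linear \<psi> using \<psi>(1) by (simp add: bounded_clinear_def)
    have inv: "\<psi> (T v) = \<psi> v" for v using \<psi>(2)[OF S_in_Z, of v] by (simp add: S_def diff)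
    have "\<psi> ((T ^^ k) x) = \<psi> x" for k by (induction k) (auto simp: inv)
    then have "\<psi> (psum n x) = real n * \<psi> x" for n
      by (induction n) (auto simp: psum_def add zero algebra_simps)
    then have ces: "\<psi> (cesaro n x) = \<psi> x" if "n > 0" for n
      using that by (simp add: cesaro_def scaleR scaleR_conv_of_real)
    obtain n where "n \<ge> 1" "cmod (\<psi> (cesaro n x) - \<psi> y) < cmod (\<psi> (x - y))"
      using y[of "cmod (\<psi> (x - y))" 1 "CBlinfun \<psi>"] ne CBlinfun_apply[OF \<psi>(1)] by auto
    then show False by (simp add: ces diff)
  qed
  ultimately show ?thesis using S_eq_0_iff by blast
qed

end

section \<open>Decay from the growth of the resolvent on the circle\<close>

lemma bounded_bilinear_scaleC:
  "bounded_bilinear (\<lambda>c (x::'a::complex_normed_vector). c *\<^sub>C x)"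
proof
  show "(r *\<^sub>R c) *\<^sub>C x = r *\<^sub>R (c *\<^sub>C x)" for r :: real and c and x :: 'a
    by (simp add: scaleR_conv_of_real scaleC_scaleC[symmetric] scaleC_of_real)
  show "\<exists>K. \<forall>c (x::'a). norm (c *\<^sub>C x) \<le> norm c * norm x * K"
    by (rule exI[of _ 1]) (simp add: norm_scaleC)
qed (simp_all add: scaleC_add_left scaleC_add_right scaleR_scaleC)

lemma bounded_linear_scaleC_left: "bounded_linear (\<lambda>c. c *\<^sub>C (x::'a::complex_normed_vector))"
  by (rule bounded_bilinear.bounded_linear_left[OF bounded_bilinear_scaleC])

lemma (in bounded_bilinear) has_vector_derivative_at_zero:
  assumes g: "(g has_vector_derivative g') (at t)" and g0: "g t = 0" and k: "isCont k t"
  shows "((\<lambda>s. prod (g s) (k s)) has_vector_derivative prod g' (k t)) (at t)"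
proof -
  obtain B where B: "\<And>a b. norm (prod a b) \<le> norm a * norm b * B" using bounded by blast
  have gd: "((\<lambda>s. norm (g s - (s - t) *\<^sub>R g') / norm (s - t)) \<longlongrightarrow> 0) (at t)"
    using g g0 by (simp add: has_vector_derivative_def has_derivative_iff_norm)
  have kt: "(k \<longlongrightarrow> k t) (at t)" using k by (simp add: isCont_def)
  have "((\<lambda>s. norm (g s - (s - t) *\<^sub>R g') / norm (s - t) * norm (k s) * B
      + norm g' * norm (k s - k t) * B) \<longlongrightarrow> 0 * norm (k t) * B + norm g' * norm (k t - k t) * B) (at t)"
    by (intro tendsto_intros gd kt)
  then have lim: "((\<lambda>s. norm (g s - (s - t) *\<^sub>R g') / norm (s - t) * norm (k s) * B
      + norm g' * norm (k s - k t) * B) \<longlongrightarrow> 0) (at t)" by simp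
  have "((\<lambda>s. norm (prod (g s) (k s) - (s - t) *\<^sub>R prod g' (k t)) / norm (s - t)) \<longlongrightarrow> 0) (at t)"
  proof (rule Lim_null_comparison[OF _ lim])
    show "\<forall>\<^sub>F s in at t. norm (norm (prod (g s) (k s) - (s - t) *\<^sub>R prod g' (k t)) / norm (s - t))
        \<le> norm (g s - (s - t) *\<^sub>R g') / norm (s - t) * norm (k s) * B + norm g' * norm (k s - k t) * B"
      unfolding eventually_at
    proof (intro exI[of _ 1] conjI ballI impI)
      fix s assume "s \<in> UNIV" and s: "s \<noteq> t \<and> dist s t < 1"
      have "prod (g s) (k s) - (s - t) *\<^sub>R prod g' (k t)
          = prod (g s - (s - t) *\<^sub>R g') (k s) + (s - t) *\<^sub>R prod g' (k s - k t)"
        by (simp add: diff_left diff_right scaleR_left scaleR_diff_right)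
      also have "norm \<dots> \<le> norm (g s - (s - t) *\<^sub>R g') * norm (k s) * B
          + norm (s - t) * (norm g' * norm (k s - k t) * B)"
        by (rule norm_triangle_le) (auto intro!: add_mono B mult_left_mono)
      finally show "norm (norm (prod (g s) (k s) - (s - t) *\<^sub>R prod g' (k t)) / norm (s - t))
        \<le> norm (g s - (s - t) *\<^sub>R g') / norm (s - t) * norm (k s) * B + norm g' * norm (k s - k t) * B"
        using s by (simp add: field_simps)
    qed simp
  qed
  then show ?thesis
    using g0 bounded_linear_scaleR_left
    by (simp add: has_vector_derivative_def has_derivative_iff_norm zero_left)
qed

definition pker :: "nat \<Rightarrow> int \<Rightarrow> real \<Rightarrow> complex" where
  "pker N n \<theta> = exp (\<i> * of_int n * of_real \<theta>) * (1 - exp (\<i> * of_real \<theta>)) ^ N"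

definition pcoeff :: "nat \<Rightarrow> int \<Rightarrow> complex" where
  "pcoeff N n = integral {0..2*pi} (pker N n)"

lemma isCont_pker: "isCont (pker N n) \<theta>"
  unfolding pker_def by (intro continuous_intros)

lemma continuous_on_pker: "continuous_on A (pker N n)"
  by (simp add: continuous_at_imp_continuous_on isCont_pker)

lemma pker_Suc: "pker (Suc N) n \<theta> = pker N n \<theta> - pker N (n + 1) \<theta>"
proof -
  have "exp (\<i> * of_int (n + 1) * of_real \<theta>) = exp (\<i> * of_int n * of_real \<theta>) * exp (\<i> * of_real \<theta>)"
    by (simp add: exp_add[symmetric] algebra_simps)
  then show ?thesis by (simp add: pker_def algebra_simps)
qed

lemma pker_shift: "pker N (n + 1) \<theta> = exp (\<i> * of_real \<theta>) * pker N n \<theta>"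
proof -
  have "exp (\<i> * of_int (n + 1) * of_real \<theta>) = exp (\<i> * of_real \<theta>) * exp (\<i> * of_int n * of_real \<theta>)"
    by (simp add: exp_add[symmetric] algebra_simps)
  then show ?thesis by (simp add: pker_def)
qed

lemma norm_pker: "cmod (pker N n \<theta>) = cmod (1 - exp (\<i> * of_real \<theta>)) ^ N"
proof -
  have "cmod (exp (\<i> * of_int n * of_real \<theta>)) = 1"
    using norm_exp_i_times[of "of_int n * \<theta>"] by (simp add: mult.assoc)
  then show ?thesis by (simp add: pker_def norm_mult norm_power)
qed

lemma pker_derivative:
  "(pker (Suc N) n has_vector_derivative (\<i> * of_int n * pker (Suc N) n \<theta>
     - \<i> * of_nat (Suc N) * exp (\<i> * of_real \<theta>) * pker N n \<theta>)) (at \<theta>)"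
proof -
  have "((\<lambda>w. exp (\<i> * of_int n * w) * (1 - exp (\<i> * w)) ^ Suc N) has_field_derivative
     (\<i> * of_int n * pker (Suc N) n \<theta> - \<i> * of_nat (Suc N) * exp (\<i> * of_real \<theta>) * pker N n \<theta>))
     (at (of_real \<theta>))"
    unfolding pker_def
    by (rule derivative_eq_intros refl)+ (simp add: algebra_simps)
  from has_vector_derivative_real_field[OF this] show ?thesis
    by (simp add: pker_def[abs_def])
qed

lemma pcoeff_0: "pcoeff 0 n = (if n = 0 then 2 * pi else 0)"
proof (cases "n = 0")
  case True
  then show ?thesis by (simp add: pcoeff_def pker_def[abs_def] scaleR_conv_of_real)
next
  case False
  have "((\<lambda>\<theta>. exp (\<i> * of_int n * of_real \<theta>) / (\<i> * of_int n)) has_vector_derivative pker 0 n \<theta>) (at \<theta> within A)" for \<theta> A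
  proof -
    have "((\<lambda>w. exp (\<i> * of_int n * w) / (\<i> * of_int n)) has_field_derivative pker 0 n \<theta>) (at (of_real \<theta>))"
      using False unfolding pker_def by (auto intro!: derivative_eq_intros)
    from has_vector_derivative_real_field[OF this] show ?thesis
      by (rule has_vector_derivative_at_within)
  qed
  then have "(pker 0 n has_integral (exp (\<i> * of_int n * of_real (2*pi)) / (\<i> * of_int n)
      - exp (\<i> * of_int n * of_real 0) / (\<i> * of_int n))) {0..2*pi}"
    by (intro fundamental_theorem_of_calculus) auto
  moreover have "exp (\<i> * of_int n * of_real (2*pi)) = 1"
    unfolding exp_eq_1 by (auto intro!: exI[of _ n])
  ultimately show ?thesis using False by (simp add: pcoeff_def integral_unique)
qed

lemma pcoeff_Suc: "pcoeff (Suc N) n = pcoeff N n - pcoeff N (n + 1)"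
  unfolding pcoeff_def pker_Suc[abs_def]
  by (intro integral_diff integrable_continuous_real continuous_on_pker)

context power_bounded_map
begin

text \<open>The solution \<open>V\<close>, vanishing for \<open>n \<le> -N\<close>, of \<open>V (n + 1) = T (V n) + pcoeff N n x\<close>.\<close>

primrec recsol :: "'a \<Rightarrow> nat \<Rightarrow> int \<Rightarrow> 'a" where
  "recsol x 0 n = (if n \<le> 0 then 0 else (2*pi) *\<^sub>R (T ^^ nat (n - 1)) x)"
| "recsol x (Suc N) n = recsol x N n - recsol x N (n + 1)"

lemma recsol_zero: "n \<le> - int N \<Longrightarrow> recsol x N n = 0"
  by (induction N arbitrary: n) auto

lemma recsol_step: "recsol x N (n + 1) = T (recsol x N n) + pcoeff N n *\<^sub>C x"
proof (induction N arbitrary: n)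
  case 0
  consider "n < 0" | "n = 0" | "n > 0" by linarith
  then show ?case
  proof cases
    case 3
    then have "nat n = Suc (nat (n - 1))" by simp
    then have "(T ^^ nat n) x = T ((T ^^ nat (n - 1)) x)" by simp
    then show ?thesis
      using 3 linear_scale[OF bounded_linear.linear[OF bl_T]] by (simp add: pcoeff_0 scaleC_zero_left)
  next
    case 2
    have "complex_of_real (2 * pi) *\<^sub>C x = (2 * pi) *\<^sub>R x" by (rule scaleC_of_real)
    then show ?thesis using 2 by (simp add: pcoeff_0 T_zero)
  qed (simp add: pcoeff_0 T_zero scaleC_zero_left)
next
  case (Suc N)
  show ?case
    using Suc[of n] Suc[of "n + 1"] by (simp add: T_diff pcoeff_Suc scaleC_diff_left)
qed

lemma recsol_pos: "recsol x N (int k + 1) = (2*pi) *\<^sub>R (T ^^ k) ((S ^^ N) x)"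
proof (induction N arbitrary: k)
  case (Suc N)
  show ?case
    using Suc[of k] Suc[of "Suc k"]
    by (simp add: S_def pow_diff funpow_swap1 scaleR_diff_right add.commute)
qed simp

end

locale resolvent_growth = power_bounded_map +
  fixes R :: "complex \<Rightarrow> 'a \<Rightarrow> 'a" and m :: nat and K :: real
  assumes R_clin: "cmod z = 1 \<Longrightarrow> z \<noteq> 1 \<Longrightarrow> bounded_clinear (R z)"
    and R_right: "cmod z = 1 \<Longrightarrow> z \<noteq> 1 \<Longrightarrow> z *\<^sub>C R z x - T (R z x) = x"
    and R_left: "cmod z = 1 \<Longrightarrow> z \<noteq> 1 \<Longrightarrow> R z (z *\<^sub>C x - T x) = x"
    and R_bound: "cmod z = 1 \<Longrightarrow> z \<noteq> 1 \<Longrightarrow> cmod (1 - z) ^ m * norm (R z x) \<le> K * norm x"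
    and K0: "K \<ge> 0" and m1: "m \<ge> 1"
begin

lemma resolvent_identity:
  assumes z: "cmod z = 1" "z \<noteq> 1" and w: "cmod w = 1" "w \<noteq> 1"
  shows "R z x - R w x = (w - z) *\<^sub>C R z (R w x)"
proof -
  interpret bounded_linear "R z" using R_clin[OF z] by (simp add: bounded_clinear_def)
  have "R z x - R w x = R z (w *\<^sub>C R w x - T (R w x)) - R z (z *\<^sub>C R w x - T (R w x))"
    by (simp add: R_right[OF w] R_left[OF z])
  also have "\<dots> = R z ((w - z) *\<^sub>C R w x)"
    by (simp add: diff[symmetric] scaleC_diff_left)
  finally show ?thesis using R_clin[OF z] by (simp add: bounded_clinear_def)
qed

definition rcirc :: "'a \<Rightarrow> real \<Rightarrow> 'a" where "rcirc x \<theta> = R (exp (\<i> * of_real \<theta>)) x"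

lemma isCont_rcirc:
  assumes "exp (\<i> * of_real \<theta>) \<noteq> 1"
  shows "isCont (rcirc x) \<theta>"
proof -
  define e where "e s = exp (\<i> * complex_of_real s)" for s
  have e1: "cmod (e s) = 1" for s by (simp add: e_def)
  have \<theta>: "e \<theta> \<noteq> 1" using assms by (simp add: e_def)
  have cont: "(e \<longlongrightarrow> e \<theta>) (at \<theta>)" unfolding e_def by (intro tendsto_intros)
  then have ev: "\<forall>\<^sub>F s in at \<theta>. e s \<noteq> 1" using \<theta> by (rule tendsto_imp_eventually_ne)
  have "((\<lambda>s. cmod (e \<theta> - e s) * (K * norm (R (e \<theta>) x) / cmod (1 - e s) ^ m)) \<longlongrightarrow>
      cmod (e \<theta> - e \<theta>) * (K * norm (R (e \<theta>) x) / cmod (1 - e \<theta>) ^ m)) (at \<theta>)"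
    using \<theta> by (intro tendsto_intros cont) simp
  then have lim: "((\<lambda>s. cmod (e \<theta> - e s) * (K * norm (R (e \<theta>) x) / cmod (1 - e s) ^ m)) \<longlongrightarrow> 0) (at \<theta>)"
    by simp
  have "((\<lambda>s. R (e s) x - R (e \<theta>) x) \<longlongrightarrow> 0) (at \<theta>)"
  proof (rule Lim_null_comparison[OF _ lim])
    show "\<forall>\<^sub>F s in at \<theta>. norm (R (e s) x - R (e \<theta>) x) \<le>
        cmod (e \<theta> - e s) * (K * norm (R (e \<theta>) x) / cmod (1 - e s) ^ m)"
      using ev
    proof eventually_elim
      case (elim s)
      have "norm (R (e s) (R (e \<theta>) x)) \<le> K * norm (R (e \<theta>) x) / cmod (1 - e s) ^ m"
        using R_bound[OF e1 elim, of "R (e \<theta>) x"] elim by (simp add: field_simps)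
      then show ?case
        using mult_left_mono[of _ _ "cmod (e \<theta> - e s)"]
        by (simp only: resolvent_identity[OF e1 elim e1 \<theta>] norm_scaleC norm_ge_zero)
    qed
  qed
  then show ?thesis
    by (simp add: isCont_def rcirc_def[abs_def] e_def LIM_zero_iff)
qed

lemma rcirc_derivative:
  assumes "exp (\<i> * of_real \<theta>) \<noteq> 1"
  shows "(rcirc x has_vector_derivative
    (- (\<i> * exp (\<i> * of_real \<theta>))) *\<^sub>C rcirc (rcirc x \<theta>) \<theta>) (at \<theta>)"
proof -
  define e where "e s = exp (\<i> * complex_of_real s)" for s
  have e1: "cmod (e s) = 1" for s by (simp add: e_def)
  have \<theta>: "e \<theta> \<noteq> 1" using assms by (simp add: e_def)
  have "((\<lambda>w. e \<theta> - exp (\<i> * w)) has_field_derivative - (\<i> * e \<theta>)) (at (of_real \<theta>))"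
    unfolding e_def by (auto intro!: derivative_eq_intros)
  from has_vector_derivative_real_field[OF this]
  have "((\<lambda>s. e \<theta> - e s) has_vector_derivative - (\<i> * e \<theta>)) (at \<theta>)" by (simp add: e_def)
  from bounded_bilinear.has_vector_derivative_at_zero[OF bounded_bilinear_scaleC this _ isCont_rcirc[OF assms]]
  have "((\<lambda>s. (e \<theta> - e s) *\<^sub>C rcirc (rcirc x \<theta>) s) has_vector_derivative
      - (\<i> * e \<theta>) *\<^sub>C rcirc (rcirc x \<theta>) \<theta>) (at \<theta>)" by simp
  then have d: "((\<lambda>s. rcirc x \<theta> + (e \<theta> - e s) *\<^sub>C rcirc (rcirc x \<theta>) s) has_vector_derivative
      - (\<i> * e \<theta>) *\<^sub>C rcirc (rcirc x \<theta>) \<theta>) (at \<theta>)"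
    using has_vector_derivative_add[OF has_vector_derivative_const[of "rcirc x \<theta>"]] by fastforce
  have op: "open {s. e s \<noteq> 1}" unfolding e_def by (intro open_Collect_neq continuous_intros)
  have eq: "rcirc x \<theta> + (e \<theta> - e s) *\<^sub>C rcirc (rcirc x \<theta>) s = rcirc x s" if "s \<in> {s. e s \<noteq> 1}" for s
    using resolvent_identity[OF e1 _ e1 \<theta>, of s x] that by (simp add: rcirc_def e_def algebra_simps)
  show ?thesis
    unfolding e_def[symmetric]
    by (rule has_vector_derivative_transform_within_open[OF d op _ eq]) (use \<theta> in simp_all)
qed

lemma norm_rcirc:
  assumes "exp (\<i> * of_real \<theta>) \<noteq> 1" "j \<ge> m"
  shows "cmod (1 - exp (\<i> * of_real \<theta>)) ^ j * norm (rcirc x \<theta>)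
    \<le> cmod (1 - exp (\<i> * of_real \<theta>)) ^ (j - m) * (K * norm x)"
proof -
  have "cmod (1 - exp (\<i> * of_real \<theta>)) ^ j * norm (rcirc x \<theta>) =
      cmod (1 - exp (\<i> * of_real \<theta>)) ^ (j - m) * (cmod (1 - exp (\<i> * of_real \<theta>)) ^ m * norm (rcirc x \<theta>))"
    using assms(2) by (simp add: power_add[symmetric] mult.assoc[symmetric])
  also have "\<dots> \<le> cmod (1 - exp (\<i> * of_real \<theta>)) ^ (j - m) * (K * norm x)"
    using R_bound[of "exp (\<i> * of_real \<theta>)" x] assms(1) by (intro mult_left_mono) (auto simp: rcirc_def)
  finally show ?thesis .
qed

definition integrand :: "int \<Rightarrow> 'a \<Rightarrow> real \<Rightarrow> 'a" where
  "integrand n x \<theta> = pker (Suc (2 * m)) n \<theta> *\<^sub>C rcirc x \<theta>"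

definition osc :: "int \<Rightarrow> 'a \<Rightarrow> 'a" where
  "osc n x = integral {0..2*pi} (integrand n x)"

lemma isCont_integrand: "isCont (integrand n x) \<theta>"
proof (cases "exp (\<i> * of_real \<theta>) = 1")
  case False
  then show ?thesis
    unfolding integrand_def[abs_def] isCont_def
    by (intro bounded_bilinear.tendsto[OF bounded_bilinear_scaleC] isCont_pker[unfolded isCont_def]
        isCont_rcirc[unfolded isCont_def])
next
  case True
  have z: "integrand n x s = 0" if "exp (\<i> * complex_of_real s) = 1" for s
    using that by (simp add: integrand_def pker_def scaleC_zero_left)
  have "((\<lambda>s. cmod (1 - exp (\<i> * complex_of_real s)) ^ Suc m * (K * norm x)) \<longlongrightarrow>
      cmod (1 - exp (\<i> * complex_of_real \<theta>)) ^ Suc m * (K * norm x)) (at \<theta>)"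
    by (intro tendsto_intros)
  then have lim: "((\<lambda>s. cmod (1 - exp (\<i> * complex_of_real s)) ^ Suc m * (K * norm x)) \<longlongrightarrow> 0) (at \<theta>)"
    using True by simp
  have le: "norm (integrand n x s) \<le> cmod (1 - exp (\<i> * complex_of_real s)) ^ Suc m * (K * norm x)" for s
  proof (cases "exp (\<i> * complex_of_real s) = 1")
    case False
    have "norm (integrand n x s) = cmod (1 - exp (\<i> * of_real s)) ^ Suc (2 * m) * norm (rcirc x s)"
      by (simp only: integrand_def norm_scaleC norm_pker)
    also have "\<dots> \<le> cmod (1 - exp (\<i> * of_real s)) ^ (Suc (2 * m) - m) * (K * norm x)"
      using False by (intro norm_rcirc) auto
    also have "Suc (2 * m) - m = Suc m" by simp
    finally show ?thesis .
  qed (use z in simp)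
  then show ?thesis
    unfolding isCont_def z[OF True] by (intro Lim_null_comparison[OF always_eventually lim]) blast
qed

lemma integrand_has_integral: "(integrand n x has_integral osc n x) {0..2*pi}"
  unfolding osc_def
  by (intro integrable_integral integrable_continuous_real continuous_at_imp_continuous_on ballI isCont_integrand)

lemma exp_i_ne_1:
  assumes "0 < \<theta>" "\<theta> < 2 * pi"
  shows "exp (\<i> * of_real \<theta>) \<noteq> 1"
proof
  assume "exp (\<i> * of_real \<theta>) = 1"
  then obtain n :: int where n: "\<theta> = 2 * of_int n * pi" by (auto simp: exp_eq_1 mult_ac)
  with assms have "0 < real_of_int n" "real_of_int n < 1"
    by (auto simp: zero_less_mult_iff)
  then have "0 < n" "n < 1" by simp_all
  then show False by linarith
qed

lemma osc_bound: "real_of_int \<bar>n\<bar> * norm (osc n x)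
  \<le> (2 * K\<^sup>2 + real (Suc (2 * m)) * 2 ^ m * K) * norm x * (2 * pi)"
proof -
  let ?z = "\<lambda>\<theta>. exp (\<i> * complex_of_real \<theta>)"
  define D where "D \<theta> = pker (Suc (2 * m)) n \<theta> *\<^sub>C ((- (\<i> * ?z \<theta>)) *\<^sub>C rcirc (rcirc x \<theta>) \<theta>)
    - (\<i> * of_nat (Suc (2 * m)) * ?z \<theta> * pker (2 * m) n \<theta>) *\<^sub>C rcirc x \<theta>" for \<theta>
  have "(integrand n x has_vector_derivative D \<theta> + (\<i> * of_int n) *\<^sub>C integrand n x \<theta>) (at \<theta>)"
    if "\<theta> \<in> {0<..<2*pi}" for \<theta>
  proof -
    have "?z \<theta> \<noteq> 1" using exp_i_ne_1 that by simp
    from bounded_bilinear.has_vector_derivative[OF bounded_bilinear_scaleC pker_derivative rcirc_derivative[OF this],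
        of "2 * m" n x]
    show ?thesis
      by (simp only: integrand_def[abs_def] D_def scaleC_diff_left scaleC_scaleC) (simp add: algebra_simps)
  qed
  then have hi: "((\<lambda>\<theta>. D \<theta> + (\<i> * of_int n) *\<^sub>C integrand n x \<theta>) has_integral
      integrand n x (2*pi) - integrand n x 0) {0..2*pi}"
    by (intro fundamental_theorem_of_calculus_interior continuous_at_imp_continuous_on ballI isCont_integrand) auto
  have "exp (\<i> * (2 * complex_of_real pi)) = 1"
    using exp_two_pi_i by (simp add: mult_ac)
  then have ends: "integrand n x 0 = 0" "integrand n x (2*pi) = 0"
    by (simp_all add: integrand_def pker_def scaleC_zero_left)
  have "((\<lambda>\<theta>. (\<i> * of_int n) *\<^sub>C integrand n x \<theta>) has_integral (\<i> * of_int n) *\<^sub>C osc n x) {0..2*pi}"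
    using has_integral_linear[OF integrand_has_integral bounded_linear_scaleC_right] by (simp add: o_def)
  from has_integral_diff[OF hi this]
  have "(D has_integral - ((\<i> * of_int n) *\<^sub>C osc n x)) {0..2*pi}"
    by (simp add: ends)
  moreover have "norm (D \<theta>) \<le> (2 * K\<^sup>2 + real (Suc (2 * m)) * 2 ^ m * K) * norm x" for \<theta>
  proof (cases "?z \<theta> = 1")
    case True
    then have "D \<theta> = 0" using m1 by (simp add: D_def pker_def scaleC_zero_left power_0_left)
    then show ?thesis using K0 by simp
  next
    case False
    define a where "a = cmod (1 - ?z \<theta>)"
    have a: "0 \<le> a" "a \<le> 2" using norm_triangle_ineq4[of 1 "?z \<theta>"] by (auto simp: a_def)
    have "a ^ m * norm (rcirc x \<theta>) \<le> K * norm x"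
      using norm_rcirc[OF False, of m x] by (simp add: a_def)
    then have "a ^ Suc m * (K * norm (rcirc x \<theta>)) \<le> a * K * (K * norm x)"
      using mult_left_mono[of "a ^ m * norm (rcirc x \<theta>)" "K * norm x" "a * K"] a K0
      by (simp add: mult_ac)
    then have "a ^ Suc (2 * m) * norm (rcirc (rcirc x \<theta>) \<theta>) \<le> a * K * (K * norm x)"
      using norm_rcirc[OF False, of "Suc (2 * m)" "rcirc x \<theta>"] by (simp add: a_def Suc_diff_le)
    also have "\<dots> \<le> 2 * K * (K * norm x)" using a K0 by (intro mult_right_mono) auto
    finally have 1: "a ^ Suc (2 * m) * norm (rcirc (rcirc x \<theta>) \<theta>) \<le> 2 * K\<^sup>2 * norm x"
      by (simp add: power2_eq_square mult_ac)
    have "a ^ (2 * m) * norm (rcirc x \<theta>) \<le> a ^ m * (K * norm x)"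
      using norm_rcirc[OF False, of "2 * m" x] by (simp add: a_def)
    also have "\<dots> \<le> 2 ^ m * (K * norm x)"
      using a K0 by (intro mult_right_mono power_mono) auto
    finally have 2: "real (Suc (2 * m)) * (a ^ (2 * m) * norm (rcirc x \<theta>)) \<le> real (Suc (2 * m)) * (2 ^ m * (K * norm x))"
      by (intro mult_left_mono) auto
    have "norm (D \<theta>) \<le> a ^ Suc (2 * m) * norm (rcirc (rcirc x \<theta>) \<theta>)
        + real (Suc (2 * m)) * (a ^ (2 * m) * norm (rcirc x \<theta>))"
      unfolding D_def
      by (rule order_trans[OF norm_triangle_ineq4])
         (simp only: norm_scaleC norm_mult norm_minus_cancel norm_pker norm_ii norm_of_nat
           norm_exp_i_times a_def mult_1 mult_1_right mult.assoc order_refl)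
    with 1 2 show ?thesis by (simp only: distrib_right mult.assoc)
  qed
  ultimately have "norm (- ((\<i> * of_int n) *\<^sub>C osc n x))
      \<le> (2 * K\<^sup>2 + real (Suc (2 * m)) * 2 ^ m * K) * norm x * measure lborel {0..2*pi}"
    using K0 by (intro has_integral_bound_real[where f = D and S = "{}"]) auto
  then show ?thesis by (simp add: norm_scaleC norm_mult)
qed

lemma osc_step: "osc (n + 1) x = T (osc n x) + pcoeff (Suc (2 * m)) n *\<^sub>C x"
proof -
  have "T (integrand n x \<theta>) = integrand (n + 1) x \<theta> - pker (Suc (2 * m)) n \<theta> *\<^sub>C x" for \<theta>
  proof (cases "exp (\<i> * complex_of_real \<theta>) = 1")
    case True
    then show ?thesis by (simp add: integrand_def pker_def T_zero scaleC_zero_left)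
  next
    case False
    have "T (rcirc x \<theta>) = exp (\<i> * of_real \<theta>) *\<^sub>C rcirc x \<theta> - x"
      using R_right[OF _ False, of x] by (simp add: rcirc_def algebra_simps)
    then show ?thesis
      by (simp add: integrand_def T_scaleC pker_shift scaleC_diff_right scaleC_scaleC mult.commute)
  qed
  moreover have "((\<lambda>\<theta>. T (integrand n x \<theta>)) has_integral T (osc n x)) {0..2*pi}"
    using has_integral_linear[OF integrand_has_integral bl_T] by (simp add: o_def)
  ultimately have hi: "((\<lambda>\<theta>. integrand (n + 1) x \<theta> - pker (Suc (2 * m)) n \<theta> *\<^sub>C x) has_integral T (osc n x)) {0..2*pi}"
    by simp
  have "((\<lambda>\<theta>. pker (Suc (2 * m)) n \<theta> *\<^sub>C x) has_integral pcoeff (Suc (2 * m)) n *\<^sub>C x) {0..2*pi}"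
    using has_integral_linear[OF integrable_integral[OF integrable_continuous_real[OF continuous_on_pker]]
        bounded_linear_scaleC_left] by (simp add: o_def pcoeff_def)
  from has_integral_add[OF hi this]
  have "(integrand (n + 1) x has_integral T (osc n x) + pcoeff (Suc (2 * m)) n *\<^sub>C x) {0..2*pi}"
    by simp
  then show ?thesis using integrand_has_integral has_integral_unique by blast
qed

lemma osc_zero:
  assumes n: "n \<le> - int (Suc (2 * m))"
  shows "osc n x = 0"
proof -
  have c0: "pcoeff (Suc (2 * m)) j *\<^sub>C x = 0" if "j < - int (Suc (2 * m))" for j
    using recsol_step[of x "Suc (2 * m)" j] that
    by (simp add: recsol_zero T_zero del: recsol.simps)
  have backward: "osc n x = (T ^^ k) (osc (n - int k) x)" for k
  proof (induction k)
    case (Suc k)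
    have "osc (n - int k) x = T (osc (n - int (Suc k)) x)"
      using osc_step[of "n - int (Suc k)" x] c0[of "n - int (Suc k)"] n by simp
    with Suc show ?case by (simp add: funpow_swap1)
  qed simp
  define C where "C = (2 * K\<^sup>2 + real (Suc (2 * m)) * 2 ^ m * K) * norm x * (2 * pi)"
  have "real k * norm (osc n x) \<le> M * C" for k
  proof -
    have "real k * norm (osc n x) \<le> real k * (M * norm (osc (n - int k) x))"
      unfolding backward[of k] by (intro mult_left_mono pow_norm) auto
    also have "\<dots> = M * (real k * norm (osc (n - int k) x))" by simp
    also have "\<dots> \<le> M * (real_of_int \<bar>n - int k\<bar> * norm (osc (n - int k) x))"
      using M1 n by (intro mult_left_mono mult_right_mono) auto
    also have "\<dots> \<le> M * C" unfolding C_def using M1 by (intro mult_left_mono osc_bound) auto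
    finally show ?thesis .
  qed
  then have "norm (osc n x) \<le> 0"
    using reals_Archimedean3[of "norm (osc n x)"] by (meson not_less)
  then show ?thesis by simp
qed

lemma osc_eq_recsol:
  assumes "n \<ge> - int (Suc (2 * m))"
  shows "osc n x = recsol x (Suc (2 * m)) n"
  using assms
proof (induction n rule: int_ge_induct)
  case base
  then show ?case by (simp add: osc_zero recsol_zero del: recsol.simps)
next
  case (step n)
  then show ?case by (simp add: osc_step recsol_step del: recsol.simps)
qed

theorem decay: "\<exists>C\<ge>0. \<forall>n x. norm ((T ^^ n) ((S ^^ Suc (2 * m)) x)) \<le> C / real (Suc n) * norm x"
proof (intro exI[of _ "2 * K\<^sup>2 + real (Suc (2 * m)) * 2 ^ m * K"] conjI allI)
  show "0 \<le> 2 * K\<^sup>2 + real (Suc (2 * m)) * 2 ^ m * K" using K0 by simp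
  fix n x
  have "osc (int n + 1) x = (2*pi) *\<^sub>R (T ^^ n) ((S ^^ Suc (2 * m)) x)"
    by (simp only: osc_eq_recsol recsol_pos)
  then have "real (Suc n) * (2 * pi * norm ((T ^^ n) ((S ^^ Suc (2 * m)) x)))
      \<le> (2 * K\<^sup>2 + real (Suc (2 * m)) * 2 ^ m * K) * norm x * (2 * pi)"
    using osc_bound[of "int n + 1" x] by (simp del: funpow.simps add: add.commute)
  then have "2 * pi * (real (Suc n) * norm ((T ^^ n) ((S ^^ Suc (2 * m)) x)))
      \<le> 2 * pi * ((2 * K\<^sup>2 + real (Suc (2 * m)) * 2 ^ m * K) * norm x)"
    by (simp only: mult_ac)
  then have "real (Suc n) * norm ((T ^^ n) ((S ^^ Suc (2 * m)) x))
      \<le> (2 * K\<^sup>2 + real (Suc (2 * m)) * 2 ^ m * K) * norm x"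
    by (rule mult_left_le_imp_le) simp
  then have "norm ((T ^^ n) ((S ^^ Suc (2 * m)) x))
      \<le> (2 * K\<^sup>2 + real (Suc (2 * m)) * 2 ^ m * K) * norm x / real (Suc n)"
    by (subst pos_le_divide_eq) (simp_all only: of_nat_0_less_iff zero_less_Suc mult.commute[of "real (Suc n)"])
  then show "norm ((T ^^ n) ((S ^^ Suc (2 * m)) x))
      \<le> (2 * K\<^sup>2 + real (Suc (2 * m)) * 2 ^ m * K) / real (Suc n) * norm x"
    by (simp only: times_divide_eq_left)
qed

end

section \<open>Convergence of the powers\<close>

locale decaying_map = power_bounded_map +
  fixes N :: nat and C :: real
  assumes refl: "reflexive_space TYPE('a)"
    and C0: "C \<ge> 0"
    and decay_N: "norm ((T ^^ n) ((S ^^ N) x)) \<le> C / real (Suc n) * norm x"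
begin

lemma decay_pow:
  "\<exists>B\<ge>0. \<forall>n x. norm ((T ^^ n) ((S ^^ (k * N)) x)) \<le> B / real (Suc n) ^ k * norm x"
proof (induction k)
  case 0
  then show ?case using pow_norm M1 by (intro exI[of _ M]) simp
next
  case (Suc k)
  then obtain B where B: "B \<ge> 0"
    "\<And>n x. norm ((T ^^ n) ((S ^^ (k * N)) x)) \<le> B / real (Suc n) ^ k * norm x" by blast
  show ?case
  proof (intro exI[of _ "2 ^ Suc k * (C * B)"] conjI allI)
    show "0 \<le> 2 ^ Suc k * (C * B)" using C0 B(1) by simp
    fix n :: nat and x :: 'a
    define a where "a = n div 2"
    define b where "b = n - a"
    have ab: "a + b = n" "real (Suc n) \<le> 2 * real (Suc a)" "real (Suc n) \<le> 2 * real (Suc b)"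
      by (auto simp: a_def b_def)
    have "(T ^^ n) ((S ^^ (Suc k * N)) x) = (T ^^ a) ((S ^^ N) ((T ^^ b) ((S ^^ (k * N)) x)))"
      by (simp add: ab(1)[symmetric] funpow_add Spow_pow)
    also have "norm \<dots> \<le> C / real (Suc a) * (B / real (Suc b) ^ k * norm x)"
      by (rule order_trans[OF decay_N mult_left_mono[OF B(2)]]) (use C0 in simp)
    also have "\<dots> = C * B * norm x * (1 / (real (Suc a) * real (Suc b) ^ k))" by simp
    also have "\<dots> \<le> C * B * norm x * (2 ^ Suc k / real (Suc n) ^ Suc k)"
    proof (rule mult_left_mono)
      have "real (Suc n) * real (Suc n) ^ k \<le> (2 * real (Suc a)) * (2 * real (Suc b)) ^ k"
        using ab by (intro mult_mono power_mono) auto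
      then have "real (Suc n) ^ Suc k \<le> 2 ^ Suc k * (real (Suc a) * real (Suc b) ^ k)"
        by (simp only: power_Suc power_mult_distrib mult_ac)
      moreover have "0 < real (Suc a) * real (Suc b) ^ k" "0 < real (Suc n) ^ Suc k"
        by (simp_all del: of_nat_Suc power_Suc)
      ultimately show "1 / (real (Suc a) * real (Suc b) ^ k) \<le> 2 ^ Suc k / real (Suc n) ^ Suc k"
        by (simp only: pos_divide_le_eq pos_le_divide_eq times_divide_eq_left mult_1)
    qed (use C0 B(1) in simp)
    also have "\<dots> = 2 ^ Suc k * (C * B) / real (Suc n) ^ Suc k * norm x" by simp
    finally show "norm ((T ^^ n) ((S ^^ (Suc k * N)) x)) \<le> 2 ^ Suc k * (C * B) / real (Suc n) ^ Suc k * norm x" .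
  qed
qed

lemma range_S_Z: "\<exists>w\<in>Z. S x = S w"
proof -
  obtain y where "T y = y" "x - y \<in> Z" using mean_ergodic[OF refl] by blast
  then show ?thesis using S_eq_0_iff[of y] by (intro bexI[of _ "x - y"]) (auto simp: S_diff)
qed

lemma S_dense_Z: "z \<in> Z \<Longrightarrow> e > 0 \<Longrightarrow> \<exists>w\<in>Z. norm (S w - z) < e"
  using Z_approx[of z e] range_S_Z by metis

lemma Z_approx_all_powers:
  "z \<in> Z \<Longrightarrow> e > 0 \<Longrightarrow> \<exists>y. norm (y - z) < e \<and> (\<forall>k. \<exists>w. y = (S ^^ k) w)"
  using dense_range_all_powers[OF bl_S S_dense_Z] by blast

lemma pow_Z_tendsto:
  assumes z: "z \<in> Z"
  shows "(\<lambda>n. (T ^^ n) z) \<longlonglongrightarrow> 0"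
proof (rule LIMSEQ_I)
  fix e :: real assume e: "e > 0"
  obtain y where y: "norm (y - z) < e / (2 * M)" "\<forall>k. \<exists>w. y = (S ^^ k) w"
    using Z_approx_all_powers[OF z, of "e / (2 * M)"] e M1 by auto
  then obtain w where w: "y = (S ^^ N) w" by blast
  have "(\<lambda>n. C * norm w / real (Suc n)) \<longlonglongrightarrow> 0"
    using lim_const_over_n[of "C * norm w"] by (rule LIMSEQ_Suc)
  then obtain n0 where n0: "\<And>n. n \<ge> n0 \<Longrightarrow> C * norm w / real (Suc n) < e / 2"
    using LIMSEQ_D[of _ 0 "e / 2"] e by (metis abs_less_iff diff_zero half_gt_zero real_norm_def)
  show "\<exists>no. \<forall>n\<ge>no. norm ((T ^^ n) z - 0) < e"
  proof (intro exI[of _ n0] allI impI)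
    fix n assume "n \<ge> n0"
    then have "C / real (Suc n) * norm w < e / 2" using n0[of n] by (simp only: times_divide_eq_left)
    then have "norm ((T ^^ n) y) < e / 2" unfolding w using decay_N[of n w] by (rule order_le_less_trans[rotated])
    moreover have "norm ((T ^^ n) (y - z)) \<le> e / 2"
      using order_trans[OF pow_norm mult_left_mono[OF less_imp_le[OF y(1)]]] M1 by simp
    moreover have "(T ^^ n) z = (T ^^ n) y - (T ^^ n) (y - z)" by (simp add: pow_diff)
    ultimately show "norm ((T ^^ n) z - 0) < e"
      using norm_triangle_ineq4[of "(T ^^ n) y" "(T ^^ n) (y - z)"] by simp
  qed
qed

definition P :: "'a \<Rightarrow> 'a" where "P x = (SOME y. T y = y \<and> x - y \<in> Z)"

lemma P_fixed: "T (P x) = P x" and P_compl: "x - P x \<in> Z"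
  using someI_ex[OF mean_ergodic[OF refl, of x]] by (auto simp: P_def)

lemma pow_minus_P: "(T ^^ n) x - P x = (T ^^ n) (x - P x)"
  by (simp add: pow_diff pow_fixed[OF P_fixed])

lemma pow_tendsto_P: "(\<lambda>n. (T ^^ n) x) \<longlonglongrightarrow> P x"
  using pow_Z_tendsto[OF P_compl[of x]] by (simp add: pow_minus_P[symmetric] LIM_zero_iff)

lemma P_add: "P (x + y) = P x + P y"
  using tendsto_add[OF pow_tendsto_P[of x] pow_tendsto_P[of y]] pow_tendsto_P[of "x + y"]
  by (simp add: pow_add LIMSEQ_unique)

lemma P_scaleC: "P (c *\<^sub>C x) = c *\<^sub>C P x"
  using bounded_linear.tendsto[OF bounded_linear_scaleC_right pow_tendsto_P[of x], of c]
    pow_tendsto_P[of "c *\<^sub>C x"]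
  by (simp add: pow_scaleC LIMSEQ_unique)

lemma P_norm: "norm (P x) \<le> M * norm x"
  by (rule Lim_bounded[OF tendsto_norm[OF pow_tendsto_P]]) (use pow_norm in auto)

lemma P_clin: "bounded_clinear P"
  by (rule bounded_clinearI[where K = M]) (auto simp: P_add P_scaleC P_norm)

lemma P_diff: "P (x - y) = P x - P y"
  using P_add[of "x - y" y] by simp

lemma P_fixed_eq: "T x = x \<Longrightarrow> P x = x"
  using pow_tendsto_P[of x] by (simp add: pow_fixed LIMSEQ_const_iff)

lemma P_eq_0_iff: "P x = 0 \<longleftrightarrow> x \<in> Z"
proof
  assume "x \<in> Z"
  then show "P x = 0" using pow_Z_tendsto pow_tendsto_P LIMSEQ_unique by blast
qed (use P_compl[of x] in simp)

lemma P_P: "P (P x) = P x" by (simp add: P_fixed_eq P_fixed)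

lemma P_pow: "P ((T ^^ n) x) = P x"
proof -
  have "(\<lambda>k. (T ^^ (k + n)) x) \<longlonglongrightarrow> P x" by (rule LIMSEQ_ignore_initial_segment[OF pow_tendsto_P])
  then show ?thesis using pow_tendsto_P[of "(T ^^ n) x"] by (simp add: pow_pow LIMSEQ_unique)
qed

lemma P_S: "P (S x) = 0" by (simp add: P_eq_0_iff S_in_Z)

definition smooth_vectors :: "'a set" where
  "smooth_vectors = {x. \<forall>k. \<exists>w. x - P x = (S ^^ k) w}"

lemma csubspace_smooth_vectors: "csubspace smooth_vectors"
  unfolding csubspace_def smooth_vectors_def
proof (intro conjI ballI allI CollectI)
  fix k
  show "\<exists>w. 0 - P 0 = (S ^^ k) w"
    using P_fixed_eq[OF T_zero] by (intro exI[of _ 0]) (simp add: Spow_zero)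
  fix x y assume "x \<in> {x. \<forall>k. \<exists>w. x - P x = (S ^^ k) w}" "y \<in> {x. \<forall>k. \<exists>w. x - P x = (S ^^ k) w}"
  then obtain v w where "x - P x = (S ^^ k) v" "y - P y = (S ^^ k) w" by blast
  then show "\<exists>w. x + y - P (x + y) = (S ^^ k) w"
    by (intro exI[of _ "v + w"]) (simp add: Spow_add P_add algebra_simps)
next
  fix k c x assume "x \<in> {x. \<forall>k. \<exists>w. x - P x = (S ^^ k) w}"
  then obtain v where "x - P x = (S ^^ k) v" by blast
  then show "\<exists>w. c *\<^sub>C x - P (c *\<^sub>C x) = (S ^^ k) w"
    by (intro exI[of _ "c *\<^sub>C v"]) (simp add: Spow_scaleC P_scaleC scaleC_diff_right[symmetric])
qed

lemma closure_smooth_vectors: "closure smooth_vectors = UNIV"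
proof -
  have "x \<in> closure smooth_vectors" for x
    unfolding closure_approachable
  proof (intro allI impI)
    fix e :: real assume "e > 0"
    then obtain y where y: "norm (y - (x - P x)) < e" "\<forall>k. \<exists>w. y = (S ^^ k) w"
      using Z_approx_all_powers[OF P_compl] by blast
    then obtain w where "y = (S ^^ 1) w" by blast
    then have "P y = 0" by (simp add: P_S)
    then have "P x + y \<in> smooth_vectors"
      using y(2) by (simp add: smooth_vectors_def P_add P_P)
    moreover have "dist (P x + y) x < e" using y(1) by (simp add: dist_norm algebra_simps)
    ultimately show "\<exists>y\<in>smooth_vectors. dist y x < e" by blast
  qed
  then show ?thesis by blast
qed

lemma smooth_vectors_fast:
  assumes "x \<in> smooth_vectors"
  shows "\<exists>B. \<forall>n. norm ((T ^^ n) x - P x) \<le> B / real (Suc n) ^ k"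
proof -
  obtain w where w: "x - P x = (S ^^ (k * N)) w" using assms by (auto simp: smooth_vectors_def)
  obtain B where "\<And>n x. norm ((T ^^ n) ((S ^^ (k * N)) x)) \<le> B / real (Suc n) ^ k * norm x"
    using decay_pow by blast
  then have "norm ((T ^^ n) x - P x) \<le> (B * norm w) / real (Suc n) ^ k" for n
    unfolding pow_minus_P w by (metis times_divide_eq_left)
  then show ?thesis by blast
qed

lemma pow_minus_P_add: "(T ^^ (m + n)) x - P x = (T ^^ m) ((T ^^ n) x - P x) - P ((T ^^ n) x - P x)"
  by (simp add: pow_diff pow_pow pow_fixed[OF P_fixed] P_diff P_pow P_P)

theorem closed_range_exponential:
  assumes cl: "closed (range S)"
  shows "\<exists>B>0. \<exists>r\<in>{0..<1}. \<forall>n x. norm ((T ^^ n) x - P x) \<le> B * r ^ n * norm x"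
proof -
  have Z: "Z = range S" using cl by (simp add: Z_def)
  have Zk: "z \<in> Z \<Longrightarrow> \<exists>w\<in>Z. z = (S ^^ k) w" for z k
  proof (induction k arbitrary: z)
    case (Suc k)
    then obtain w where "w \<in> Z" "z = (S ^^ k) w" by blast
    moreover obtain v where "v \<in> Z" "w = S v" using \<open>w \<in> Z\<close> range_S_Z unfolding Z by (metis rangeE)
    ultimately show ?case by (auto simp: funpow_swap1)
  qed auto
  have "\<exists>K. \<forall>n x. norm (real (Suc n) *\<^sub>R ((T ^^ n) x - P x)) \<le> K * norm x"
  proof (rule uniform_boundedness)
    show "bounded_linear (\<lambda>x. real (Suc n) *\<^sub>R ((T ^^ n) x - P x))" for n
      using pow_clin[of n] P_clin unfolding bounded_clinear_def
      by (intro bounded_linear_const_scaleR bounded_linear_sub) auto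
    fix x
    obtain w where w: "x - P x = (S ^^ N) w" using Zk[OF P_compl] by blast
    show "\<exists>B. \<forall>n. norm (real (Suc n) *\<^sub>R ((T ^^ n) x - P x)) \<le> B"
    proof (intro exI allI)
      fix n
      have "norm (real (Suc n) *\<^sub>R ((T ^^ n) x - P x)) \<le> real (Suc n) * (C / real (Suc n) * norm w)"
        unfolding norm_scaleR pow_minus_P w using decay_N by (intro mult_mono) auto
      then show "norm (real (Suc n) *\<^sub>R ((T ^^ n) x - P x)) \<le> C * norm w" by (simp del: of_nat_Suc)
    qed
  qed
  then obtain K where K: "\<And>n x. real (Suc n) * norm ((T ^^ n) x - P x) \<le> K * norm x"
    by (auto simp del: of_nat_Suc)
  obtain k :: nat where k: "2 * K < real k" "k \<ge> 1"
    using reals_Archimedean2[of "max (2 * K) 1"] by (metis max_less_iff_conj less_imp_le of_nat_1 of_nat_le_iff)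
  have half: "norm ((T ^^ k) x - P x) \<le> 1/2 * norm x" for x
  proof -
    have "real k * norm ((T ^^ k) x - P x) \<le> real (Suc k) * norm ((T ^^ k) x - P x)"
      by (intro mult_right_mono) auto
    also have "\<dots> \<le> K * norm x" by (rule K)
    also have "\<dots> \<le> real k / 2 * norm x" using k by (intro mult_right_mono) auto
    finally have "real k * norm ((T ^^ k) x - P x) \<le> real k * (1/2 * norm x)" by simp
    then show ?thesis using k(2) by (subst (asm) mult_le_cancel_left_pos) auto
  qed
  have ka: "norm ((T ^^ (k * a + b)) x - P x) \<le> (1/2) ^ a * (2 * M) * norm x" for a b x
  proof (induction a)
    case 0
    have "norm ((T ^^ b) x - P x) \<le> 2 * M * norm x"
      using norm_triangle_ineq4[of "(T ^^ b) x" "P x"] pow_norm[of b x] P_norm[of x] by simp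
    then show ?case by simp
  next
    case (Suc a)
    have "norm ((T ^^ (k + (k * a + b))) x - P x) \<le> 1/2 * norm ((T ^^ (k * a + b)) x - P x)"
      unfolding pow_minus_P_add by (rule half)
    with Suc show ?case by (simp add: add.assoc)
  qed
  define r where "r = root k (1/2)"
  have rk: "r ^ k = 1/2" and r: "0 < r" "r < 1" using k(2) by (auto simp: r_def)
  have "norm ((T ^^ n) x - P x) \<le> (4 * M) * r ^ n * norm x" for n x
  proof -
    define a where "a = n div k"
    define b where "b = n mod k"
    have n: "n = k * a + b" by (simp add: a_def b_def)
    have "b < k" using k(2) by (simp add: b_def)
    then have "1/2 \<le> r ^ b" using r by (simp add: rk[symmetric] power_decreasing)
    then have "(1/2) ^ a * 1 \<le> (1/2) ^ a * (2 * r ^ b)" by (intro mult_left_mono) auto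
    also have "(1/2) ^ a * (2 * r ^ b) = 2 * r ^ n" by (simp add: n power_add power_mult rk)
    finally have "(1/2) ^ a * (2 * M * norm x) \<le> 2 * r ^ n * (2 * M * norm x)"
      using M1 by (intro mult_right_mono) auto
    moreover have "norm ((T ^^ n) x - P x) \<le> (1/2) ^ a * (2 * M) * norm x" unfolding n by (rule ka)
    ultimately show ?thesis by (simp add: mult_ac)
  qed
  then show ?thesis using r M1 by (intro exI[of _ "4 * M"] conjI bexI[of _ r]) auto
qed

end

section \<open>Slow convergence\<close>

context decaying_map
begin

lemma cesaro_near:
  assumes "n > 0" and "\<And>i. i < n \<Longrightarrow> norm ((T ^^ i) y - v) \<le> \<delta>"
  shows "norm (cesaro n y - v) \<le> \<delta>"
proof -
  have "cesaro n y - v = (1 / real n) *\<^sub>R (\<Sum>i<n. (T ^^ i) y - v)"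
    using assms(1) by (simp add: cesaro_def psum_def sum_subtractf scaleR_diff_right sum_constant_scaleR)
  moreover have "norm (\<Sum>i<n. (T ^^ i) y - v) \<le> real n * \<delta>"
    using assms(2) by (intro order_trans[OF norm_sum] sum_bounded_above[THEN order_trans]) auto
  ultimately show ?thesis using assms(1) by (simp add: field_simps)
qed

lemma approximate_eigenvector:
  assumes ncl: "\<not> closed (range S)" and e: "e > 0"
  shows "\<exists>w. norm (S w) = 1 \<and> norm (S (S w)) < e"
proof (rule ccontr)
  assume no: "\<nexists>w. norm (S w) = 1 \<and> norm (S (S w)) < e"
  interpret S: bounded_linear S by (rule bl_S)
  have "e * norm (S w) \<le> norm (S (S w))" for w
  proof (cases "S w = 0")
    case False
    have "S ((1 / norm (S w)) *\<^sub>R w) = (1 / norm (S w)) *\<^sub>R S w" by (simp add: S.scaleR)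
    moreover have "e \<le> norm (S (S ((1 / norm (S w)) *\<^sub>R w)))"
    proof -
      have "norm (S ((1 / norm (S w)) *\<^sub>R w)) = 1" using False by (simp add: S.scaleR)
      then show ?thesis using no by (meson not_less)
    qed
    ultimately show ?thesis using False by (simp add: S.scaleR field_simps)
  qed (simp add: S_zero)
  then have "range S \<subseteq> {z. e * norm z \<le> norm (S z)}" by auto
  moreover have "closed {z. e * norm z \<le> norm (S z)}"
    by (intro closed_Collect_le continuous_intros S.continuous_on)
  ultimately have below: "\<forall>z\<in>Z. e * norm z \<le> norm (S z)"
    unfolding Z_def using closure_minimal by blast
  have "subspace Z"
    using csubspace_Z by (auto simp: subspace_def csubspace_def scaleC_of_real[symmetric])
  then have "complete (S ` Z)"
    using complete_isometric_image[OF e _ bl_S] below complete_eq_closed[of Z] closed_Z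
    by (auto simp: mult.commute)
  moreover have "S ` Z = range S" using range_S_Z by force
  ultimately show False using ncl complete_eq_closed by metis
qed

lemma test_pair:
  assumes ncl: "\<not> closed (range S)" and e: "e > 0"
  shows "\<exists>w \<psi>. bounded_clinear \<psi> \<and> norm (S w) = 1 \<and> norm (S (S w)) \<le> e \<and>
    (\<forall>y. cmod (\<psi> (S y)) \<le> M * (1 + M) * norm y) \<and> (\<forall>y. cmod (\<psi> (S (S y))) \<le> e * norm y) \<and>
    (\<forall>n\<le>J. 1/2 \<le> Re (\<psi> (S ((T ^^ n) (S w)))))"
proof -
  obtain n0 :: nat where n0: "(1 + M) * (1 + M) / e < real n0" using reals_Archimedean2 by blast
  moreover have "0 < (1 + M) * (1 + M) / e" using M1 e by simp
  ultimately have n0_pos: "n0 > 0" by linarith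
  define e' where "e' = min e (1 / (4 * M * real (n0 + J)))"
  have e': "e' > 0" "e' \<le> e" "real (n0 + J) * (M * e') \<le> 1/4"
  proof -
    have pos: "real (n0 + J) > 0" using n0_pos by simp
    show "e' > 0" "e' \<le> e" using e M1 pos by (auto simp: e'_def)
    have "real (n0 + J) * (M * e') \<le> real (n0 + J) * (M * (1 / (4 * M * real (n0 + J))))"
      using M1 by (intro mult_left_mono) (auto simp: e'_def)
    also have "\<dots> = 1/4" using M1 pos by simp
    finally show "real (n0 + J) * (M * e') \<le> 1/4" .
  qed
  obtain w where w: "norm (S w) = 1" "norm (S (S w)) < e'"
    using approximate_eigenvector[OF ncl e'(1)] by blast
  define v where "v = S w"
  obtain \<psi>0 :: "'a \<Rightarrow> complex" where \<psi>0: "bounded_clinear \<psi>0" "\<And>x. cmod (\<psi>0 x) \<le> norm x" "\<psi>0 v = 1"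
    using norming_functional[of v] w(1) by (auto simp: v_def)
  interpret \<psi>0: bounded_linear \<psi>0 using \<psi>0(1) by (simp add: bounded_clinear_def)
  have "(\<lambda>m. (T ^^ m) v) \<longlonglongrightarrow> 0" unfolding v_def by (rule pow_Z_tendsto[OF S_in_Z])
  then obtain m where m: "norm ((T ^^ m) v) < 1 / (4 * M * M)"
    using LIMSEQ_D[of "\<lambda>m. (T ^^ m) v" 0 "1 / (4 * M * M)"] M1 by force
  define \<psi> where "\<psi> y = \<psi>0 (cesaro n0 (psum m y))" for y
  have \<psi>S: "\<psi> (S y) = \<psi>0 (cesaro n0 (y - (T ^^ m) y))" for y by (simp add: \<psi>_def psum_S)
  have diff_norm: "norm (y - (T ^^ m) y) \<le> (1 + M) * norm y" for y
    using norm_triangle_ineq4[of y "(T ^^ m) y"] pow_norm[of m y] by (simp add: algebra_simps)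
  have "bounded_clinear \<psi>"
  proof (rule bounded_clinearI)
    show "\<psi> (x + y) = \<psi> x + \<psi> y" for x y by (simp add: \<psi>_def psum_add cesaro_add \<psi>0.add)
    show "\<psi> (c *\<^sub>C x) = c *\<^sub>C \<psi> x" for c x
      using \<psi>0(1) by (simp add: \<psi>_def psum_scaleC cesaro_scaleC bounded_clinear_def)
    show "norm (\<psi> x) \<le> (M * (real m * M)) * norm x" for x
    proof -
      have "norm (\<psi> x) \<le> M * norm (psum m x)"
        unfolding \<psi>_def by (rule order_trans[OF \<psi>0(2) cesaro_norm])
      also have "\<dots> \<le> M * (real m * (M * norm x))" using M1 by (intro mult_left_mono psum_norm) auto
      finally show ?thesis by (simp add: mult_ac)
    qed
  qed
  moreover have "cmod (\<psi> (S y)) \<le> M * (1 + M) * norm y" for y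
  proof -
    have "cmod (\<psi> (S y)) \<le> M * norm (y - (T ^^ m) y)"
      unfolding \<psi>S by (rule order_trans[OF \<psi>0(2) cesaro_norm])
    also have "\<dots> \<le> M * ((1 + M) * norm y)" using M1 by (intro mult_left_mono diff_norm) auto
    finally show ?thesis by (simp add: mult_ac)
  qed
  moreover have "cmod (\<psi> (S (S y))) \<le> e * norm y" for y
  proof -
    have "cmod (\<psi> (S (S y))) \<le> norm (cesaro n0 (S (y - (T ^^ m) y)))"
      unfolding \<psi>S S_pow S_diff[symmetric] by (rule \<psi>0(2))
    also have "\<dots> \<le> (1 + M) * norm (y - (T ^^ m) y) / real n0" by (rule cesaro_S_norm)
    also have "\<dots> \<le> (1 + M) * ((1 + M) * norm y) / real n0"
      using M1 by (intro divide_right_mono mult_left_mono diff_norm) auto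
    also have "\<dots> = (1 + M) * (1 + M) / real n0 * norm y" by simp
    also have "\<dots> \<le> e * norm y"
      using n0 e n0_pos by (intro mult_right_mono) (auto simp: field_simps)
    finally show ?thesis .
  qed
  moreover have "1/2 \<le> Re (\<psi> (S ((T ^^ n) (S w))))" if n: "n \<le> J" for n
  proof -
    have "norm (cesaro n0 ((T ^^ n) v) - v) \<le> 1/4"
    proof (rule cesaro_near[OF n0_pos])
      fix i assume "i < n0"
      have "norm ((T ^^ (i + n)) v - v) \<le> real (i + n) * (M * norm (S v))" by (rule pow_orbit_diff)
      also have "\<dots> \<le> real (n0 + J) * (M * e')"
        using \<open>i < n0\<close> n M1 w(2) by (intro mult_mono) (auto simp: v_def)
      finally show "norm ((T ^^ i) ((T ^^ n) v) - v) \<le> 1/4" using e'(3) by (simp add: pow_pow)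
    qed
    then have 1: "cmod (\<psi>0 (cesaro n0 ((T ^^ n) v)) - 1) \<le> 1/4"
      using \<psi>0(2)[of "cesaro n0 ((T ^^ n) v) - v"] by (simp add: \<psi>0.diff \<psi>0(3))
    have "cmod (\<psi>0 (cesaro n0 ((T ^^ n) ((T ^^ m) v)))) \<le> M * norm ((T ^^ n) ((T ^^ m) v))"
      by (rule order_trans[OF \<psi>0(2) cesaro_norm])
    also have "\<dots> \<le> M * (M * norm ((T ^^ m) v))" using M1 by (intro mult_left_mono pow_norm) auto
    also have "\<dots> \<le> M * (M * (1 / (4 * M * M)))" using M1 m by (intro mult_left_mono) auto
    also have "\<dots> = 1/4" using M1 by simp
    finally have 2: "cmod (\<psi>0 (cesaro n0 ((T ^^ n) ((T ^^ m) v)))) \<le> 1/4" .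
    have "\<psi> (S ((T ^^ n) v)) = \<psi>0 (cesaro n0 ((T ^^ n) v)) - \<psi>0 (cesaro n0 ((T ^^ n) ((T ^^ m) v)))"
      by (simp add: \<psi>S cesaro_diff \<psi>0.diff pow_pow add.commute)
    then show ?thesis
      using abs_Re_le_cmod[of "\<psi>0 (cesaro n0 ((T ^^ n) v)) - 1"] 1
        abs_Re_le_cmod[of "\<psi>0 (cesaro n0 ((T ^^ n) ((T ^^ m) v)))"] 2
      by (simp add: v_def)
  qed
  ultimately show ?thesis using w e'(2) by (intro exI[of _ w] exI[of _ \<psi>]) auto
qed

text \<open>The times \<open>J k\<close> separate the scales: up to time \<open>J k\<close> the pairs from \<open>k\<close> on have not moved,
  and from time \<open>J k\<close> on the vectors before \<open>k\<close> have died out.\<close>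

lemma test_system:
  assumes ncl: "\<not> closed (range S)" and q: "0 < q" "q < 1" and \<delta>: "\<delta> > 0"
    and r: "r \<longlonglongrightarrow> 0" "\<And>n. r n \<le> (1::real)"
  shows "\<exists>(w::nat \<Rightarrow> 'a) (\<psi>::nat \<Rightarrow> 'a \<Rightarrow> complex) (J::nat \<Rightarrow> nat).
    (\<forall>k. bounded_clinear (\<psi> k) \<and> norm (S (w k)) = 1 \<and> (\<forall>y. cmod (\<psi> k (S y)) \<le> M * (1 + M) * norm y) \<and>
      (\<forall>n\<le>J k. 1/2 \<le> Re (\<psi> k (S ((T ^^ n) (S (w k))))))) \<and>
    (\<forall>i j n. i \<noteq> j \<longrightarrow> cmod (\<psi> j (S ((T ^^ n) (S (w i))))) \<le> \<delta> * q ^ max i j) \<and>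
    J 0 = 0 \<and> strict_mono J \<and>
    (\<forall>k n. J k \<le> n \<longrightarrow> r n \<le> (q\<^sup>2) ^ k \<and> (\<Sum>i<k. q ^ i * norm ((T ^^ n) (S (w i)))) \<le> \<delta> * (q\<^sup>2) ^ k)"
proof -
  define good where "good J e w \<psi> \<longleftrightarrow> bounded_clinear \<psi> \<and> norm (S w) = 1 \<and> norm (S (S w)) \<le> e \<and>
    (\<forall>y. cmod (\<psi> (S y)) \<le> M * (1 + M) * norm y) \<and> (\<forall>y. cmod (\<psi> (S (S y))) \<le> e * norm y) \<and>
    (\<forall>n\<le>J. 1/2 \<le> Re (\<psi> (S ((T ^^ n) (S w)))))" for J :: nat and e w and \<psi> :: "'a \<Rightarrow> complex"
  define bd where "bd B w \<psi> \<longleftrightarrow> B \<ge> 1 \<and> norm w \<le> B \<and> (\<forall>y. cmod (\<psi> y) \<le> B * norm y)"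
    for B and w :: 'a and \<psi> :: "'a \<Rightarrow> complex"
  have good_ex: "\<exists>w \<psi>. good J e w \<psi>" if "e > 0" for J e
    using test_pair[OF ncl that, of J] by (simp add: good_def)
  have bd_ex: "\<exists>B\<ge>B0. bd B w \<psi>" if cl: "bounded_clinear \<psi>" for B0 and w :: 'a and \<psi> :: "'a \<Rightarrow> complex"
  proof -
    obtain K where K: "\<And>y. norm (\<psi> y) \<le> norm y * K"
      using bounded_linear.bounded[of \<psi>] cl by (auto simp: bounded_clinear_def)
    define B where "B = max (max B0 1) (max (norm w) K)"
    have "K \<le> B" by (simp add: B_def)
    then have "cmod (\<psi> y) \<le> B * norm y" for y
      using K[of y] mult_left_mono[of K B "norm y"] by (simp add: mult.commute)
    then show ?thesis by (intro exI[of _ B]) (auto simp: bd_def B_def)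
  qed
  define Pr where "Pr k s \<longleftrightarrow> (case s of (h, B, J, w, \<psi>) \<Rightarrow>
      h \<longlonglongrightarrow> 0 \<and> bd B w \<psi> \<and> (\<exists>e. good J e w \<psi>) \<and>
      (k = 0 \<longrightarrow> J = 0 \<and> h = (\<lambda>n. norm ((T ^^ n) (S w)))))"
    for k :: nat and s :: "(nat \<Rightarrow> real) \<times> real \<times> nat \<times> 'a \<times> ('a \<Rightarrow> complex)"
  define Tr where "Tr k s s' \<longleftrightarrow> (case (s, s') of ((h, B, J, w, \<psi>), (h', B', J', w', \<psi>')) \<Rightarrow>
      J < J' \<and> (\<forall>n\<ge>J'. r n \<le> (q\<^sup>2) ^ Suc k \<and> h n \<le> \<delta> * (q\<^sup>2) ^ Suc k) \<and>
      good J' (\<delta> * q ^ Suc k / (M * B)) w' \<psi>' \<and> B \<le> B' \<and>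
      h' = (\<lambda>n. h n + q ^ Suc k * norm ((T ^^ n) (S w'))))"
    for k :: nat and s s' :: "(nat \<Rightarrow> real) \<times> real \<times> nat \<times> 'a \<times> ('a \<Rightarrow> complex)"
  have orbit0: "(\<lambda>n. norm ((T ^^ n) (S w))) \<longlonglongrightarrow> 0" for w
    using tendsto_norm[OF pow_Z_tendsto[OF S_in_Z[of w]]] by simp
  have "\<exists>s. \<forall>k. Pr k (s k) \<and> Tr k (s k) (s (Suc k))"
  proof (rule dependent_nat_choice)
    obtain w \<psi> where g: "good 0 1 w \<psi>" using good_ex[OF zero_less_one, of 0] by blast
    then have "bounded_clinear \<psi>" by (simp add: good_def)
    then obtain B where "bd B w \<psi>" using bd_ex by blast
    then have "Pr 0 (\<lambda>n. norm ((T ^^ n) (S w)), B, 0, w, \<psi>)"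
      using g orbit0 by (auto simp: Pr_def)
    then show "\<exists>s. Pr 0 s" by blast
  next
    fix s k assume "Pr k s"
    then obtain h B J w \<psi> where s: "s = (h, B, J, w, \<psi>)" and h: "h \<longlonglongrightarrow> 0" and B: "bd B w \<psi>"
      by (cases s) (auto simp: Pr_def)
    have pos: "\<delta> * q ^ Suc k / (M * B) > 0" "(q\<^sup>2) ^ Suc k > 0" "\<delta> * (q\<^sup>2) ^ Suc k > 0"
      using \<delta> q M1 B by (auto simp: bd_def)
    have "\<forall>\<^sub>F n in sequentially. r n < (q\<^sup>2) ^ Suc k \<and> h n < \<delta> * (q\<^sup>2) ^ Suc k"
      by (intro eventually_conj order_tendstoD(2)[OF r(1) pos(2)] order_tendstoD(2)[OF h pos(3)])
    then obtain J1 where J1: "\<And>n. n \<ge> J1 \<Longrightarrow> r n < (q\<^sup>2) ^ Suc k \<and> h n < \<delta> * (q\<^sup>2) ^ Suc k"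
      unfolding eventually_sequentially by blast
    define J' where "J' = max J1 (Suc J)"
    obtain w' \<psi>' where g: "good J' (\<delta> * q ^ Suc k / (M * B)) w' \<psi>'" using good_ex[OF pos(1)] by blast
    then have "bounded_clinear \<psi>'" by (simp add: good_def)
    then obtain B' where B': "B' \<ge> B" "bd B' w' \<psi>'" using bd_ex by blast
    define h' where "h' n = h n + q ^ Suc k * norm ((T ^^ n) (S w'))" for n
    have "h' \<longlonglongrightarrow> 0 + q ^ Suc k * 0"
      unfolding h'_def by (intro tendsto_intros h orbit0)
    then have "Pr (Suc k) (h', B', J', w', \<psi>')" using g B' by (auto simp: Pr_def)
    moreover have "Tr k s (h', B', J', w', \<psi>')"
      using g B' J1 less_imp_le by (auto simp: Tr_def s h'_def J'_def)
    ultimately show "\<exists>s'. Pr (Suc k) s' \<and> Tr k s s'" by blast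
  qed
  then obtain s where s: "\<And>k. Pr k (s k)" "\<And>k. Tr k (s k) (s (Suc k))" by blast
  define h where "h k = fst (s k)" for k
  define B where "B k = fst (snd (s k))" for k
  define J where "J k = fst (snd (snd (s k)))" for k
  define w where "w k = fst (snd (snd (snd (s k))))" for k
  define \<psi> where "\<psi> k = snd (snd (snd (snd (s k))))" for k
  have sk: "s k = (h k, B k, J k, w k, \<psi> k)" for k
    by (simp add: h_def B_def J_def w_def \<psi>_def)
  have bd: "bd (B k) (w k) (\<psi> k)" and g: "\<exists>e. good (J k) e (w k) (\<psi> k)" for k
    using s(1)[of k] unfolding sk Pr_def by auto
  have J0: "J 0 = 0" and h0: "h 0 = (\<lambda>n. norm ((T ^^ n) (S (w 0))))"
    using s(1)[of 0] unfolding sk Pr_def by auto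
  have JSuc: "J k < J (Suc k)" and rh: "\<And>n. J (Suc k) \<le> n \<Longrightarrow> r n \<le> (q\<^sup>2) ^ Suc k \<and> h k n \<le> \<delta> * (q\<^sup>2) ^ Suc k"
    and gSuc: "good (J (Suc k)) (\<delta> * q ^ Suc k / (M * B k)) (w (Suc k)) (\<psi> (Suc k))"
    and BSuc: "B k \<le> B (Suc k)"
    and hSuc: "h (Suc k) = (\<lambda>n. h k n + q ^ Suc k * norm ((T ^^ n) (S (w (Suc k)))))" for k
    using s(2)[of k] unfolding sk Tr_def by (auto simp del: power_Suc)
  have Bmono: "i \<le> j \<Longrightarrow> B i \<le> B j" for i j using lift_Suc_mono_le[of B] BSuc by blast
  have h: "h k n = (\<Sum>i<Suc k. q ^ i * norm ((T ^^ n) (S (w i))))" for k n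
    by (induction k) (auto simp: h0 hSuc)
  have cross: "cmod (\<psi> (Suc k) (S ((T ^^ n) (S (w i))))) \<le> \<delta> * q ^ Suc k \<and>
      cmod (\<psi> i (S ((T ^^ n) (S (w (Suc k)))))) \<le> \<delta> * q ^ Suc k" if i: "i \<le> k" for i k n
  proof
    define e where "e = \<delta> * q ^ Suc k / (M * B k)"
    have B1: "B k \<ge> 1" using bd[of k] by (simp add: bd_def)
    have eB: "e * (M * B k) = \<delta> * q ^ Suc k" using B1 M1 by (simp add: e_def)
    have e0: "e \<ge> 0" using \<delta> q M1 B1 by (simp add: e_def)
    have wi: "norm (w i) \<le> B k" using bd[of i] Bmono[OF i] by (simp add: bd_def)
    have "cmod (\<psi> (Suc k) (S ((T ^^ n) (S (w i))))) = cmod (\<psi> (Suc k) (S (S ((T ^^ n) (w i)))))"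
      by (simp add: S_pow)
    also have "\<dots> \<le> e * norm ((T ^^ n) (w i))" using gSuc[of k] by (simp add: good_def e_def)
    also have "\<dots> \<le> e * (M * B k)"
      using e0 M1 order_trans[OF pow_norm mult_left_mono[OF wi]] by (intro mult_left_mono) auto
    finally show "cmod (\<psi> (Suc k) (S ((T ^^ n) (S (w i))))) \<le> \<delta> * q ^ Suc k" using eB by simp
    have "cmod (\<psi> i (S ((T ^^ n) (S (w (Suc k)))))) \<le> B i * norm ((T ^^ n) (S (S (w (Suc k)))))"
      using bd[of i] by (simp add: bd_def S_pow)
    also have "\<dots> \<le> B k * (M * e)"
    proof (intro mult_mono Bmono i)
      have "norm ((T ^^ n) (S (S (w (Suc k))))) \<le> M * norm (S (S (w (Suc k))))" by (rule pow_norm)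
      also have "\<dots> \<le> M * e" using gSuc[of k] M1 by (intro mult_left_mono) (auto simp: good_def e_def)
      finally show "norm ((T ^^ n) (S (S (w (Suc k))))) \<le> M * e" .
    qed (use B1 in auto)
    finally show "cmod (\<psi> i (S ((T ^^ n) (S (w (Suc k)))))) \<le> \<delta> * q ^ Suc k"
      using eB by (simp add: mult_ac)
  qed
  have "cmod (\<psi> j (S ((T ^^ n) (S (w i))))) \<le> \<delta> * q ^ max i j" if ij: "i \<noteq> j" for i j n
  proof (cases "i < j")
    case True
    then obtain k where "j = Suc k" "i \<le> k" by (cases j) auto
    then show ?thesis using cross[of i k n] by (simp add: max_def del: power_Suc)
  next
    case False
    with ij obtain k where "i = Suc k" "j \<le> k" by (cases i) auto
    then show ?thesis using cross[of j k n] by (simp add: max_def del: power_Suc)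
  qed
  moreover have "r n \<le> (q\<^sup>2) ^ k \<and> (\<Sum>i<k. q ^ i * norm ((T ^^ n) (S (w i)))) \<le> \<delta> * (q\<^sup>2) ^ k"
    if "J k \<le> n" for k n
  proof (cases k)
    case 0
    then show ?thesis using r(2)[of n] \<delta> by simp
  next
    case (Suc l)
    then show ?thesis using rh[of l n] that h[of l n] by simp
  qed
  moreover have "strict_mono J" using JSuc by (simp add: strict_mono_Suc_iff)
  ultimately show ?thesis
    using g J0 unfolding good_def
    by (intro exI[of _ w] exI[of _ \<psi>] exI[of _ J] conjI allI impI) blast+
qed

lemma weakly_slow_normalized:
  assumes ncl: "\<not> closed (range S)" and r: "r \<longlonglongrightarrow> 0" "\<And>n. r n \<le> (1::real)"
  shows "\<exists>x \<phi>. bounded_clinear \<phi> \<and> (\<forall>n. r n \<le> Re (\<phi> ((T ^^ n) x - P x)))"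
proof -
  define D where "D = M * (1 + M)"
  define A where "A = D + 4 * D * M + 5"
  define c where "c = A / (1 + A)"
  define q where "q = sqrt c"
  define \<delta> where "\<delta> = (1 - q) / 4"
  have D: "D \<ge> 0" using M1 by (simp add: D_def)
  then have A: "A > 0" using M1 by (simp add: A_def add_nonneg_pos)
  have c: "0 < c" "c < 1" "c / (1 - c) = A" using A by (auto simp: c_def field_simps)
  have q: "0 < q" "q < 1" "q\<^sup>2 = c" using c by (auto simp: q_def)
  have \<delta>: "\<delta> > 0" "\<delta> / (1 - q) = 1/4" using q by (auto simp: \<delta>_def field_simps)
  have sumq: "summable (\<lambda>k. q ^ k)" "(\<Sum>k. q ^ k) = 1 / (1 - q)"
    using q suminf_geometric[of q] by (auto simp: summable_geometric)
  have qq: "q ^ k * q ^ k = c ^ k" for k by (simp add: q(3)[symmetric] power2_eq_square power_mult_distrib)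
  obtain w :: "nat \<Rightarrow> 'a" and \<psi> :: "nat \<Rightarrow> 'a \<Rightarrow> complex" and J :: "nat \<Rightarrow> nat" where
    pair: "\<forall>k. bounded_clinear (\<psi> k) \<and> norm (S (w k)) = 1 \<and> (\<forall>y. cmod (\<psi> k (S y)) \<le> M * (1 + M) * norm y) \<and>
      (\<forall>n\<le>J k. 1/2 \<le> Re (\<psi> k (S ((T ^^ n) (S (w k))))))"
    and off: "\<forall>i j n. i \<noteq> j \<longrightarrow> cmod (\<psi> j (S ((T ^^ n) (S (w i))))) \<le> \<delta> * q ^ max i j"
    and J: "J 0 = 0" "strict_mono J"
    and late: "\<forall>k n. J k \<le> n \<longrightarrow> r n \<le> c ^ k \<and> (\<Sum>i<k. q ^ i * norm ((T ^^ n) (S (w i)))) \<le> \<delta> * c ^ k"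
    using test_system[OF ncl q(1,2) \<delta>(1) r] unfolding q(3) by blast
  have \<psi>: "bounded_clinear (\<psi> k)" and u1: "norm (S (w k)) = 1"
    and \<psi>D: "cmod (\<psi> k (S y)) \<le> D * norm y" for k y
    using pair by (auto simp: D_def)
  have diag: "1/2 \<le> Re (\<psi> k (S ((T ^^ n) (S (w k)))))" if "n \<le> J k" for k n
    using pair that by blast
  define u where "u k = S (w k)" for k
  define f where "f j y = \<psi> j (S y)" for j y
  have "bounded_clinear (f j)" for j
    using bounded_clinear_compose[OF \<psi>[of j] S_clin] by (simp add: f_def[abs_def])
  then have f_add: "f j (x + y) = f j x + f j y" and f_scaleC: "f j (a *\<^sub>C x) = a * f j x" for j a x y
    using linear_add[OF bounded_linear.linear, of "f j"] by (simp_all add: bounded_clinear_def scaleC_complex_def)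
  have fD: "cmod (f j y) \<le> D * norm y" for j y by (simp add: f_def \<psi>D)
  have fsum_norm: "summable (\<lambda>j. norm (complex_of_real (q ^ j) * f j y))" for y
  proof (rule summable_comparison_test'[of "\<lambda>j. q ^ j * (D * norm y)" 0])
    show "summable (\<lambda>j. q ^ j * (D * norm y))" by (intro summable_mult2 sumq)
  qed (use fD q in \<open>auto simp: norm_mult norm_power intro!: mult_left_mono\<close>)
  have fsum: "summable (\<lambda>j. complex_of_real (q ^ j) * f j y)" for y
    by (rule summable_norm_cancel[OF fsum_norm])
  define \<phi> where "\<phi> y = (\<Sum>j. complex_of_real (q ^ j) * f j y)" for y
  have \<phi>_norm: "cmod (\<phi> y) \<le> D / (1 - q) * norm y" for y
  proof -
    have "cmod (\<phi> y) \<le> (\<Sum>j. q ^ j * (D * norm y))"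
      unfolding \<phi>_def
      by (rule norm_suminf_le)
         (use fD q in \<open>auto simp: norm_mult norm_power intro!: mult_left_mono summable_mult2 sumq\<close>)
    also have "\<dots> = (\<Sum>j. q ^ j) * (D * norm y)" by (rule suminf_mult2[OF sumq(1), symmetric])
    finally show ?thesis by (simp add: sumq(2))
  qed
  have \<phi>: "bounded_clinear \<phi>"
  proof (rule bounded_clinearI[OF _ _ \<phi>_norm])
    show "\<phi> (x + y) = \<phi> x + \<phi> y" for x y
      unfolding \<phi>_def f_add distrib_left by (rule suminf_add[OF fsum fsum, symmetric])
    show "\<phi> (a *\<^sub>C x) = a *\<^sub>C \<phi> x" for a x
      unfolding \<phi>_def f_scaleC scaleC_complex_def
      by (subst suminf_mult[OF fsum, symmetric]) (simp add: mult_ac)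
  qed
  have usum: "summable (\<lambda>k. q ^ k *\<^sub>R u k)"
    by (rule summable_norm_cancel) (use sumq(1) q u1 in \<open>simp add: u_def\<close>)
  define x where "x = (\<Sum>k. q ^ k *\<^sub>R u k)"
  interpret \<phi>: bounded_linear \<phi> using \<phi> by (simp add: bounded_clinear_def)
  interpret PP: bounded_linear P using P_clin by (simp add: bounded_clinear_def)
  have "P x = 0"
    unfolding x_def PP.suminf[OF usum] by (simp add: PP.scaleR u_def P_S)
  moreover have "r n \<le> Re (\<phi> ((T ^^ n) x))" for n
  proof -
    interpret Tn: bounded_linear "T ^^ n" using pow_clin[of n] by (simp add: bounded_clinear_def)
    define a where "a i = \<phi> ((T ^^ n) (u i))" for i
    have asum: "(\<lambda>i. q ^ i *\<^sub>R a i) sums \<phi> ((T ^^ n) x)"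
      using \<phi>.sums[OF Tn.sums[OF summable_sums[OF usum]]]
      by (simp add: x_def a_def Tn.scaleR \<phi>.scaleR)
    have bsum: "(\<lambda>i. q ^ i * Re (a i)) sums Re (\<phi> ((T ^^ n) x))"
      using sums_Re[OF asum] by simp
    have a_diag: "cmod (a i - complex_of_real (q ^ i) * f i ((T ^^ n) (u i))) \<le> q ^ i / 4" for i
    proof -
      define g where "g j = (if j = i then 0 else complex_of_real (q ^ j) * f j ((T ^^ n) (u i)))" for j
      have "(\<lambda>j. complex_of_real (q ^ j) * f j ((T ^^ n) (u i))
            - (if j = i then complex_of_real (q ^ j) * f j ((T ^^ n) (u i)) else 0))
          sums (a i - complex_of_real (q ^ i) * f i ((T ^^ n) (u i)))"
        unfolding a_def \<phi>_def
        by (intro sums_diff summable_sums fsum sums_single)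
      then have "g sums (a i - complex_of_real (q ^ i) * f i ((T ^^ n) (u i)))"
        by (rule sums_cong[THEN iffD1, rotated]) (simp add: g_def)
      then have "a i - complex_of_real (q ^ i) * f i ((T ^^ n) (u i)) = suminf g" by (rule sums_unique)
      also have "cmod (suminf g) \<le> (\<Sum>j. q ^ j * (\<delta> * q ^ i))"
      proof (rule norm_suminf_le)
        fix j
        show "norm (g j) \<le> q ^ j * (\<delta> * q ^ i)"
        proof (cases "j = i")
          case False
          have "cmod (f j ((T ^^ n) (u i))) \<le> \<delta> * q ^ max i j"
            using off False by (simp add: f_def u_def)
          also have "\<dots> \<le> \<delta> * q ^ i" using q \<delta> by (intro mult_left_mono power_decreasing) auto
          finally show ?thesis using False q by (simp add: g_def norm_mult norm_power mult_left_mono)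
        qed (use q \<delta> in \<open>simp add: g_def\<close>)
      qed (intro summable_mult2 sumq)
      also have "\<dots> = (\<Sum>j. q ^ j) * (\<delta> * q ^ i)" by (rule suminf_mult2[OF sumq(1), symmetric])
      also have "\<dots> = \<delta> / (1 - q) * q ^ i" by (simp add: sumq(2))
      finally show ?thesis by (simp add: \<delta>(2))
    qed
    have "\<exists>k. J k \<le> n \<and> n < J (Suc k)"
    proof -
      have "\<exists>m. n < J m" using seq_suble[OF J(2), of "Suc n"] by (intro exI[of _ "Suc n"]) simp
      then obtain m where m: "n < J m" "\<And>l. l < m \<Longrightarrow> \<not> n < J l"
        using exists_least_iff[of "\<lambda>m. n < J m"] by blast
      then obtain k where "m = Suc k" using J(1) by (cases m) auto
      then show ?thesis using m by (intro exI[of _ k]) (auto simp: not_less)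
    qed
    then obtain k where k: "J k \<le> n" "n < J (Suc k)" by blast
    have early: "- (D / 4) * c ^ k \<le> (\<Sum>i<k. q ^ i * Re (a i))"
    proof -
      have "(\<Sum>i<k. - (D / (1 - q)) * (q ^ i * norm ((T ^^ n) (u i)))) \<le> (\<Sum>i<k. q ^ i * Re (a i))"
      proof (rule sum_mono)
        fix i
        have "- (D / (1 - q) * norm ((T ^^ n) (u i))) \<le> Re (a i)"
          using abs_Re_le_cmod[of "a i"] \<phi>_norm[of "(T ^^ n) (u i)"] unfolding a_def by linarith
        then have "q ^ i * - (D / (1 - q) * norm ((T ^^ n) (u i))) \<le> q ^ i * Re (a i)"
          using q by (intro mult_left_mono) auto
        then show "- (D / (1 - q)) * (q ^ i * norm ((T ^^ n) (u i))) \<le> q ^ i * Re (a i)"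
          by (simp add: mult_ac)
      qed
      moreover have "D / (1 - q) * (\<Sum>i<k. q ^ i * norm ((T ^^ n) (u i))) \<le> D / (1 - q) * (\<delta> * c ^ k)"
        using D q late k(1) by (intro mult_left_mono) (auto simp: u_def)
      moreover have "D / (1 - q) * (\<delta> * c ^ k) = D * (\<delta> / (1 - q)) * c ^ k" by simp
      moreover have "(\<Sum>i<k. - (D / (1 - q)) * (q ^ i * norm ((T ^^ n) (u i)))) =
          - (D / (1 - q) * (\<Sum>i<k. q ^ i * norm ((T ^^ n) (u i))))"
        by (simp only: sum_distrib_left mult_minus_left sum_negf)
      moreover have "- (D / 4) * c ^ k = - (D * (1 / 4) * c ^ k)" by simp
      ultimately show ?thesis unfolding \<delta>(2) by linarith
    qed
    have middle: "- (D * M + 1/4) * c ^ k \<le> q ^ k * Re (a k)"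
    proof -
      have "cmod (f k ((T ^^ n) (u k))) \<le> D * (M * norm (u k))"
        by (rule order_trans[OF fD mult_left_mono[OF pow_norm D]])
      then have "cmod (complex_of_real (q ^ k) * f k ((T ^^ n) (u k))) \<le> q ^ k * (D * M)"
        using q u1[of k] by (simp add: norm_mult norm_power mult_left_mono u_def)
      then have "cmod (a k) \<le> q ^ k * (D * M) + q ^ k / 4"
        using a_diag[of k] norm_triangle_sub[of "a k" "complex_of_real (q ^ k) * f k ((T ^^ n) (u k))"] by linarith
      then have "- (q ^ k * (D * M + 1/4)) \<le> Re (a k)"
        using abs_Re_le_cmod[of "a k"] by (simp add: algebra_simps)
      then have "q ^ k * - (q ^ k * (D * M + 1/4)) \<le> q ^ k * Re (a k)"
        using q by (intro mult_left_mono) auto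
      moreover have "q ^ k * - (q ^ k * (D * M + 1/4)) = - (D * M + 1/4) * c ^ k"
        unfolding qq[symmetric] by (simp only: mult_minus_left mult_minus_right mult_ac)
      ultimately show ?thesis by (simp only:)
    qed
    have tail: "c ^ Suc k / (1 - c) / 4 \<le> (\<Sum>i. q ^ (i + Suc k) * Re (a (i + Suc k)))"
    proof -
      have "(\<Sum>i. c ^ Suc k / 4 * c ^ i) \<le> (\<Sum>i. q ^ (i + Suc k) * Re (a (i + Suc k)))"
      proof (rule suminf_le)
        fix i
        let ?i = "i + Suc k"
        have "J (Suc k) \<le> J ?i" using J(2) by (simp add: strict_mono_less_eq)
        then have "1/2 \<le> Re (f ?i ((T ^^ n) (u ?i)))" using diag[of n ?i] k(2) by (simp add: f_def u_def)
        then have "q ^ ?i * (1/2) \<le> Re (complex_of_real (q ^ ?i) * f ?i ((T ^^ n) (u ?i)))"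
          using q by (simp only: times_complex.sel Re_complex_of_real Im_complex_of_real mult_zero_left diff_zero)
            (rule mult_left_mono, auto)
        moreover have "\<bar>Re (a ?i - complex_of_real (q ^ ?i) * f ?i ((T ^^ n) (u ?i)))\<bar> \<le> q ^ ?i / 4"
          using abs_Re_le_cmod a_diag order_trans by blast
        ultimately have "q ^ ?i / 4 \<le> Re (a ?i)" by (simp only: minus_complex.sel)
        then have "q ^ ?i * (q ^ ?i / 4) \<le> q ^ ?i * Re (a ?i)"
          using q by (intro mult_left_mono) auto
        moreover have "q ^ ?i * (q ^ ?i / 4) = c ^ Suc k / 4 * c ^ i"
          using qq[of ?i] by (simp add: power_add mult_ac)
        ultimately show "c ^ Suc k / 4 * c ^ i \<le> q ^ ?i * Re (a ?i)" by simp
      next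
        show "summable (\<lambda>i. c ^ Suc k / 4 * c ^ i)" using c by (intro summable_mult summable_geometric) auto
        show "summable (\<lambda>i. q ^ (i + Suc k) * Re (a (i + Suc k)))"
          using summable_ignore_initial_segment[OF sums_summable[OF bsum], of "Suc k"] by simp
      qed
      moreover have "(\<Sum>i. c ^ Suc k / 4 * c ^ i) = c ^ Suc k / (1 - c) / 4"
        using c by (subst suminf_mult) (auto simp: summable_geometric suminf_geometric mult.commute)
      ultimately show ?thesis by (simp only:)
    qed
    have "Re (\<phi> ((T ^^ n) x)) = (\<Sum>i. q ^ (i + Suc k) * Re (a (i + Suc k))) + (\<Sum>i<Suc k. q ^ i * Re (a i))"
      unfolding sums_unique[OF bsum] by (rule suminf_split_initial_segment[OF sums_summable[OF bsum]])
    moreover have "c ^ Suc k / (1 - c) / 4 = D * c ^ k / 4 + D * M * c ^ k + 5 / 4 * c ^ k"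
    proof -
      have "c ^ Suc k / (1 - c) / 4 = c / (1 - c) * c ^ k / 4" by simp
      also have "\<dots> = A * c ^ k / 4" by (simp only: c(3))
      also have "\<dots> = D * c ^ k / 4 + D * M * c ^ k + 5 / 4 * c ^ k" by (simp add: A_def algebra_simps)
      finally show ?thesis .
    qed
    moreover have "- (D / 4) * c ^ k = - (D * c ^ k / 4)" by simp
    moreover have "- (D * M + 1/4) * c ^ k = - (D * M * c ^ k) - c ^ k / 4" by (simp add: algebra_simps)
    ultimately have "c ^ k \<le> Re (\<phi> ((T ^^ n) x))"
      using early middle tail unfolding sum.lessThan_Suc by linarith
    then show ?thesis using late k(1) order_trans by blast
  qed
  ultimately show ?thesis using \<phi> by (intro exI[of _ x] exI[of _ \<phi>]) simp
qed

theorem weakly_slow: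
  assumes ncl: "\<not> closed (range S)" and r: "r \<longlonglongrightarrow> (0::real)"
  shows "\<exists>x \<phi>. bounded_clinear \<phi> \<and> (\<forall>n. r n \<le> Re (\<phi> ((T ^^ n) x - P x)))"
proof -
  obtain B where B: "B > 0" "\<And>n. \<bar>r n\<bar> \<le> B"
    using Bseq_def convergent_imp_Bseq[of r] r convergent_def by (metis real_norm_def)
  have "(\<lambda>n. r n / B) \<longlonglongrightarrow> 0 / B" using B(1) by (intro tendsto_intros r) simp
  moreover have "r n / B \<le> 1" for n using B(2)[of n] B(1) by (simp add: divide_le_eq)
  ultimately obtain x \<phi> where \<phi>: "bounded_clinear \<phi>" "\<And>n. r n / B \<le> Re (\<phi> ((T ^^ n) x - P x))"
    using weakly_slow_normalized[OF ncl, of "\<lambda>n. r n / B"] by auto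
  have "r n \<le> Re (\<phi> ((T ^^ n) (complex_of_real B *\<^sub>C x) - P (complex_of_real B *\<^sub>C x)))" for n
    using \<phi>(2)[of n] \<phi>(1) B(1)
    by (simp add: pow_scaleC P_scaleC scaleC_diff_right[symmetric] bounded_clinear_def
        scaleC_complex_def field_simps)
  then show ?thesis using \<phi>(1) by blast
qed

theorem slow:
  assumes ncl: "\<not> closed (range S)" and r: "r \<longlonglongrightarrow> (0::real)"
  shows "\<exists>x. \<forall>n. r n \<le> norm ((T ^^ n) x - P x)"
proof -
  obtain x \<phi> where \<phi>: "bounded_clinear \<phi>" "\<And>n. r n \<le> Re (\<phi> ((T ^^ n) x - P x))"
    using weakly_slow[OF assms] by blast
  obtain K where K: "\<And>y. norm (\<phi> y) \<le> norm y * K" "K > 0"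
    using \<phi>(1) bounded_linear.pos_bounded unfolding bounded_clinear_def by blast
  have "r n \<le> norm ((T ^^ n) (complex_of_real K *\<^sub>C x) - P (complex_of_real K *\<^sub>C x))" for n
    using \<phi>(2)[of n] complex_Re_le_cmod[of "\<phi> ((T ^^ n) x - P x)"] K(1)[of "(T ^^ n) x - P x"] K(2)
    by (simp add: pow_scaleC P_scaleC scaleC_diff_right[symmetric] norm_scaleC mult.commute)
  then show ?thesis by blast
qed

end

section \<open>Resolvents of bounded operators and the main theorem\<close>

lemma cblinfun_eqI: "(\<And>x. f *\<^sub>V x = g *\<^sub>V x) \<Longrightarrow> f = g"
  by (metis cblinfun_apply_inject ext)

lemma cblinfun_power_apply: "cblinfun_power T n *\<^sub>V x = ((*\<^sub>V) T ^^ n) x"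
  by (induction n) (auto simp: cblinfun_id.rep_eq cblinfun_compose.rep_eq)

lemma power_bounded_imp_map:
  assumes "power_bounded T"
  shows "\<exists>M. power_bounded_map ((*\<^sub>V) T) M"
proof -
  obtain M0 where M0: "\<And>n. n \<ge> 1 \<Longrightarrow> norm (cblinfun_power T n) \<le> M0"
    using assms unfolding power_bounded_def bdd_above_def by auto
  have "norm (((*\<^sub>V) T ^^ n) x) \<le> max 1 M0 * norm x" for n x
  proof (cases "n = 0")
    case True
    then show ?thesis using mult_right_mono[of 1 "max 1 M0" "norm x"] by simp
  next
    case False
    then have "norm (cblinfun_power T n) \<le> max 1 M0" using M0[of n] by simp
    then show ?thesis
      using cblinfun_norm_apply[of "cblinfun_power T n" x]
      by (metis cblinfun_power_apply mult_right_mono norm_ge_zero order_trans)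
  qed
  then have "power_bounded_map ((*\<^sub>V) T) (max 1 M0)"
    by unfold_locales (auto simp: cblinfun_bounded_clinear)
  then show ?thesis by blast
qed

lemma resolvent_is_inverse:
  assumes "z \<notin> spectrum T"
  shows "is_cblinfun_inverse (z *\<^sub>C cblinfun_id - T) (resolvent z T)"
proof -
  obtain R where R: "is_cblinfun_inverse (z *\<^sub>C cblinfun_id - T) R"
    using assms by (auto simp: spectrum_def)
  have "R' = R" if R': "is_cblinfun_inverse (z *\<^sub>C cblinfun_id - T) R'" for R'
  proof -
    let ?A = "z *\<^sub>C cblinfun_id - T"
    have 1: "R *\<^sub>V (?A *\<^sub>V x) = x" "?A *\<^sub>V (R' *\<^sub>V x) = x" for x
      using R R' unfolding is_cblinfun_inverse_def
      by (metis cblinfun_compose.rep_eq cblinfun_id.rep_eq)+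
    have "R' *\<^sub>V x = R *\<^sub>V x" for x using 1(1)[of "R' *\<^sub>V x"] 1(2)[of x] by simp
    then show ?thesis by (rule cblinfun_eqI)
  qed
  then show ?thesis unfolding resolvent_def using R by (rule theI[rotated])
qed

lemma resolvent_apply:
  assumes "z \<notin> spectrum T"
  shows "z *\<^sub>C (resolvent z T *\<^sub>V x) - T *\<^sub>V (resolvent z T *\<^sub>V x) = x"
    and "resolvent z T *\<^sub>V (z *\<^sub>C x - T *\<^sub>V x) = x"
proof -
  let ?A = "z *\<^sub>C cblinfun_id - T" and ?R = "resolvent z T"
  have A: "?A *\<^sub>V x = z *\<^sub>C x - T *\<^sub>V x" for x
    by (simp add: minus_cblinfun.rep_eq scaleC_cblinfun.rep_eq cblinfun_id.rep_eq)
  have "?A o\<^sub>C\<^sub>L ?R = cblinfun_id" "?R o\<^sub>C\<^sub>L ?A = cblinfun_id"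
    using resolvent_is_inverse[OF assms] by (auto simp: is_cblinfun_inverse_def)
  then have "?A *\<^sub>V (?R *\<^sub>V x) = x" "?R *\<^sub>V (?A *\<^sub>V x) = x"
    by (metis cblinfun_compose.rep_eq cblinfun_id.rep_eq)+
  then show "z *\<^sub>C (?R *\<^sub>V x) - T *\<^sub>V (?R *\<^sub>V x) = x" "?R *\<^sub>V (z *\<^sub>C x - T *\<^sub>V x) = x"
    by (simp_all add: A)
qed

lemma resolvent_locally_bounded:
  assumes z: "z \<notin> spectrum T" and w: "w \<notin> spectrum T"
    and close: "cmod (w - z) * norm (resolvent w T) \<le> 1/2"
  shows "norm (resolvent z T) \<le> 2 * norm (resolvent w T)"
proof -
  let ?Rz = "resolvent z T" and ?Rw = "resolvent w T"
  interpret bounded_linear "(*\<^sub>V) ?Rz" by (rule cblinfun_bounded_linear)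
  have "norm (?Rz *\<^sub>V x) \<le> (norm ?Rw + norm ?Rz / 2) * norm x" for x
  proof -
    have "?Rz *\<^sub>V x - ?Rw *\<^sub>V x =
        ?Rz *\<^sub>V (w *\<^sub>C (?Rw *\<^sub>V x) - T *\<^sub>V ?Rw *\<^sub>V x) - ?Rz *\<^sub>V (z *\<^sub>C (?Rw *\<^sub>V x) - T *\<^sub>V ?Rw *\<^sub>V x)"
      by (simp add: resolvent_apply[OF w] resolvent_apply[OF z])
    also have "\<dots> = ?Rz *\<^sub>V ((w - z) *\<^sub>C (?Rw *\<^sub>V x))" by (simp add: diff[symmetric] scaleC_diff_left)
    finally have "norm (?Rz *\<^sub>V x - ?Rw *\<^sub>V x) \<le> norm ?Rz * (cmod (w - z) * norm (?Rw *\<^sub>V x))"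
      using cblinfun_norm_apply[of ?Rz "(w - z) *\<^sub>C (?Rw *\<^sub>V x)"] by (simp add: norm_scaleC)
    also have "\<dots> \<le> norm ?Rz * (cmod (w - z) * (norm ?Rw * norm x))"
      by (intro mult_left_mono cblinfun_norm_apply) auto
    also have "\<dots> \<le> norm ?Rz * (1/2 * norm x)"
      using mult_right_mono[OF close, of "norm x"] by (intro mult_left_mono) (auto simp: mult.assoc)
    finally show ?thesis
      using norm_triangle_sub[of "?Rz *\<^sub>V x" "?Rw *\<^sub>V x"] cblinfun_norm_apply[of ?Rw x]
      by (simp add: algebra_simps)
  qed
  then have "norm ?Rz \<le> norm ?Rw + norm ?Rz / 2" by (intro cblinfun_norm_bound) auto
  then show ?thesis by simp
qed

lemma resolvent_polynomial_growth:
  assumes sp: "spectrum T \<inter> {z. cmod z = 1} \<subseteq> {1}" and \<alpha>: "\<alpha> \<ge> 1"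
    and growth: "(\<lambda>\<theta>::real. norm (resolvent (exp (\<i> * of_real \<theta>)) T)) \<in> O[at 0](\<lambda>\<theta>. \<bar>\<theta>\<bar> powr (- \<alpha>))"
  shows "\<exists>(m::nat) K. m \<ge> 1 \<and> K \<ge> 0 \<and>
    (\<forall>z. cmod z = 1 \<longrightarrow> z \<noteq> 1 \<longrightarrow> cmod (1 - z) ^ m * norm (resolvent z T) \<le> K)"
proof -
  define e where "e \<theta> = exp (\<i> * complex_of_real \<theta>)" for \<theta>
  define \<rho> where "\<rho> \<theta> = norm (resolvent (e \<theta>) T)" for \<theta>
  have e1: "cmod (e \<theta>) = 1" for \<theta> by (simp add: e_def)
  obtain c where c: "c > 0" "\<forall>\<^sub>F \<theta> in at 0. norm (\<rho> \<theta>) \<le> c * norm (\<bar>\<theta>\<bar> powr (- \<alpha>))"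
    using growth unfolding \<rho>_def e_def by (elim landau_o.bigE)
  then obtain d0 where d0: "d0 > 0" "\<And>\<theta>. \<theta> \<noteq> 0 \<Longrightarrow> \<bar>\<theta>\<bar> < d0 \<Longrightarrow> \<rho> \<theta> \<le> c * \<bar>\<theta>\<bar> powr (- \<alpha>)"
    unfolding eventually_at by (auto simp: \<rho>_def)
  define d where "d = min d0 1"
  have d: "0 < d" "d \<le> 1" "d \<le> d0" using d0(1) by (auto simp: d_def)
  define m where "m = nat \<lceil>\<alpha>\<rceil>"
  have m: "m \<ge> 1" "\<alpha> \<le> real m" using \<alpha> by (auto simp: m_def) linarith+
  have near: "cmod (1 - e \<theta>) ^ m * \<rho> \<theta> \<le> c" if \<theta>: "\<theta> \<noteq> 0" "\<bar>\<theta>\<bar> < d" for \<theta>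
  proof -
    have "cmod (1 - e \<theta>) = 2 * \<bar>sin (\<theta> / 2)\<bar>"
      using dist_exp_i_1[of \<theta>] by (simp add: e_def dist_norm norm_minus_commute)
    also have "\<dots> \<le> \<bar>\<theta>\<bar>" using abs_sin_x_le_abs_x[of "\<theta> / 2"] by simp
    finally have "cmod (1 - e \<theta>) ^ m \<le> \<bar>\<theta>\<bar> ^ m" by (intro power_mono) auto
    also have "\<bar>\<theta>\<bar> ^ m = \<bar>\<theta>\<bar> powr real m" using \<theta>(1) by (simp add: powr_realpow)
    also have "\<dots> \<le> \<bar>\<theta>\<bar> powr \<alpha>"
      using \<theta> d m(2) by (intro powr_mono') auto
    finally have "cmod (1 - e \<theta>) ^ m * \<rho> \<theta> \<le> \<bar>\<theta>\<bar> powr \<alpha> * (c * \<bar>\<theta>\<bar> powr (- \<alpha>))"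
      using d0(2)[of \<theta>] \<theta> d by (intro mult_mono) (auto simp: \<rho>_def)
    also have "\<dots> = c * (\<bar>\<theta>\<bar> powr \<alpha> * \<bar>\<theta>\<bar> powr (- \<alpha>))" by simp
    also have "\<bar>\<theta>\<bar> powr \<alpha> * \<bar>\<theta>\<bar> powr (- \<alpha>) = 1" using \<theta>(1) by (simp flip: powr_add)
    finally show ?thesis by simp
  qed
  define \<Theta> where "\<Theta> = {-pi..-d} \<union> {d..pi}"
  have e_ne: "e \<theta> \<noteq> 1" if "\<theta> \<in> \<Theta>" for \<theta>
  proof
    assume "e \<theta> = 1"
    then obtain n :: int where n: "\<theta> = 2 * of_int n * pi" by (auto simp: e_def exp_eq_1 mult_ac)
    have "\<bar>\<theta>\<bar> \<le> pi" "\<theta> \<noteq> 0" using that d by (auto simp: \<Theta>_def)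
    then have "\<bar>2 * real_of_int n\<bar> * pi \<le> 1 * pi" "n \<noteq> 0" using n by (auto simp: abs_mult)
    then have "\<bar>2 * real_of_int n\<bar> \<le> 1" by (meson mult_le_cancel_right_pos pi_gt_zero)
    then show False using \<open>n \<noteq> 0\<close> by linarith
  qed
  have nsp: "e \<theta> \<notin> spectrum T" if "e \<theta> \<noteq> 1" for \<theta> using sp e1[of \<theta>] that by auto
  have "\<Theta> \<subseteq> (\<Union>t\<in>\<Theta>. {s. cmod (e t - e s) * \<rho> t < 1/2})" by auto
  moreover have "open {s. cmod (e t - e s) * \<rho> t < 1/2}" for t
    unfolding e_def by (intro open_Collect_less continuous_intros)
  moreover have "compact \<Theta>" by (simp add: \<Theta>_def compact_Un)
  ultimately obtain F where F: "F \<subseteq> \<Theta>" "finite F" "\<Theta> \<subseteq> (\<Union>t\<in>F. {s. cmod (e t - e s) * \<rho> t < 1/2})"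
    by (metis (lifting) compactE_image)
  define K where "K = max c (2 ^ m * (2 * (\<Sum>t\<in>F. \<rho> t)))"
  have "cmod (1 - z) ^ m * norm (resolvent z T) \<le> K" if z: "cmod z = 1" "z \<noteq> 1" for z
  proof -
    have "z \<noteq> 0" using z by auto
    then have ez: "e (Arg z) = z" using Arg_eq[of z] z(1) unfolding e_def by (metis mult_1 of_real_1)
    have Arg: "- pi < Arg z" "Arg z \<le> pi" using Arg_bounded[of z] by auto
    show ?thesis
    proof (cases "\<bar>Arg z\<bar> < d")
      case True
      have "Arg z \<noteq> 0" using ez z(2) by (auto simp: e_def)
      then show ?thesis using near[of "Arg z"] True by (simp add: ez \<rho>_def K_def)
    next
      case False
      then have "Arg z \<in> \<Theta>" using Arg by (auto simp: \<Theta>_def)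
      then obtain t where t: "t \<in> F" "cmod (e t - z) * \<rho> t < 1/2" using F(3) ez by auto
      have "norm (resolvent z T) \<le> 2 * \<rho> t"
        unfolding \<rho>_def
        using t F(1) nsp[of t] nsp[of "Arg z"] e_ne[of t] z
        by (intro resolvent_locally_bounded) (auto simp: ez \<rho>_def)
      also have "\<dots> \<le> 2 * (\<Sum>t\<in>F. \<rho> t)"
        using member_le_sum[of t F \<rho>] t(1) F(2) by (simp add: \<rho>_def)
      finally have "norm (resolvent z T) \<le> 2 * (\<Sum>t\<in>F. \<rho> t)" .
      moreover have "cmod (1 - z) \<le> 2" using norm_triangle_ineq4[of 1 z] z by simp
      ultimately have "cmod (1 - z) ^ m * norm (resolvent z T) \<le> 2 ^ m * (2 * (\<Sum>t\<in>F. \<rho> t))"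
        by (intro mult_mono power_mono) auto
      then show ?thesis by (simp add: K_def)
    qed
  qed
  then show ?thesis using m(1) c(1) by (intro exI[of _ m] exI[of _ K]) (auto simp: K_def)
qed

lemma inverse_power_bound_imp_smallo:
  fixes f :: "nat \<Rightarrow> real"
  assumes f: "\<And>n. 0 \<le> f n" "\<And>n. f n \<le> B / real (Suc n) ^ Suc k"
  shows "f \<in> o(\<lambda>n. 1 / real n ^ k)"
proof (rule smalloI_tendsto)
  have bound: "norm (f n / (1 / real n ^ k)) \<le> B / real (Suc n)" for n
  proof -
    have B: "0 \<le> B" using order_trans[OF f(1) f(2)[of 0]] by simp
    have "f n * real n ^ k \<le> B / real (Suc n) ^ Suc k * real (Suc n) ^ k"
      using f B by (intro mult_mono power_mono) auto
    also have "\<dots> = B / real (Suc n)" by (simp del: of_nat_Suc)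
    finally show ?thesis using f(1)[of n] by simp
  qed
  have lim: "(\<lambda>n. B / real (Suc n)) \<longlonglongrightarrow> 0" using lim_const_over_n[of B] by (rule LIMSEQ_Suc)
  show "(\<lambda>n. f n / (1 / real n ^ k)) \<longlonglongrightarrow> 0"
    by (rule Lim_null_comparison[OF always_eventually[OF allI] lim]) (rule bound)
  show "\<forall>\<^sub>F n in sequentially. 1 / real n ^ k \<noteq> 0"
    using eventually_gt_at_top[of 0] by eventually_elim simp
qed

theorem theorem2p1:
  fixes T :: "'a::complex_banach \<Rightarrow>\<^sub>C\<^sub>L 'a" and \<alpha> :: real
  defines "Z \<equiv> closure (cblinfun_range (cblinfun_id - T))"
  assumes "reflexive_space TYPE('a)"
    and "power_bounded T"
    and "spectrum T \<inter> {z. cmod z = 1} \<subseteq> {1}"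
    and "\<alpha> \<ge> 1"
    and "(\<lambda>\<theta>::real. norm (resolvent (exp (\<i> * of_real \<theta>)) T)) \<in> O[at 0](\<lambda>\<theta>. \<bar>\<theta>\<bar> powr (- \<alpha>))"
  shows "direct_sum_decomposition (Fix T) Z \<and>
    (\<exists>P. is_projection_along P (Fix T) Z \<and>
      (\<forall>x. (\<lambda>n. norm (cblinfun_power T n *\<^sub>V x - P *\<^sub>V x)) \<longlonglongrightarrow> 0) \<and>
      (closed (cblinfun_range (cblinfun_id - T)) \<longrightarrow>
        (\<exists>C>0. \<exists>r\<in>{0..<1}. \<forall>n. norm (cblinfun_power T n - P) \<le> C * r ^ n)) \<and>
      (\<not> closed (cblinfun_range (cblinfun_id - T)) \<longrightarrow>
        arbitrarily_slow (\<lambda>n. cblinfun_power T n - P) \<and>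
        weakly_arbitrarily_slow (\<lambda>n. cblinfun_power T n - P)) \<and>
      (\<exists>X\<^sub>0. csubspace X\<^sub>0 \<and> closure X\<^sub>0 = UNIV \<and>
        (\<forall>x\<in>X\<^sub>0. superpolynomially_fast (\<lambda>n. cblinfun_power T n - P) x)))"
proof -
  obtain M where "power_bounded_map ((*\<^sub>V) T) M" using power_bounded_imp_map[OF assms(3)] by blast
  then interpret pb: power_bounded_map "(*\<^sub>V) T" M .
  obtain m :: nat and K where m: "m \<ge> 1" "K \<ge> 0"
    and K: "\<And>z. cmod z = 1 \<Longrightarrow> z \<noteq> 1 \<Longrightarrow> cmod (1 - z) ^ m * norm (resolvent z T) \<le> K"
    using resolvent_polynomial_growth[OF assms(4-6)] by blast
  have nsp: "z \<notin> spectrum T" if "cmod z = 1" "z \<noteq> 1" for z using assms(4) that by auto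
  interpret rg: resolvent_growth "(*\<^sub>V) T" M "\<lambda>z. (*\<^sub>V) (resolvent z T)" m K
  proof unfold_locales
    fix z :: complex and x :: 'a assume z: "cmod z = 1" "z \<noteq> 1"
    show "bounded_clinear ((*\<^sub>V) (resolvent z T))" by (rule cblinfun_bounded_clinear)
    show "z *\<^sub>C (resolvent z T *\<^sub>V x) - T *\<^sub>V (resolvent z T *\<^sub>V x) = x"
      "resolvent z T *\<^sub>V (z *\<^sub>C x - T *\<^sub>V x) = x"
      by (rule resolvent_apply[OF nsp[OF z]])+
    have "cmod (1 - z) ^ m * norm (resolvent z T *\<^sub>V x) \<le> cmod (1 - z) ^ m * (norm (resolvent z T) * norm x)"
      by (intro mult_left_mono cblinfun_norm_apply) auto
    also have "\<dots> \<le> K * norm x"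
      using mult_right_mono[OF K[OF z], of "norm x"] by (simp add: mult.assoc)
    finally show "cmod (1 - z) ^ m * norm (resolvent z T *\<^sub>V x) \<le> K * norm x" .
  qed (use m in auto)
  obtain C where C: "C \<ge> 0"
    "\<And>n x. norm (((*\<^sub>V) T ^^ n) ((pb.S ^^ Suc (2 * m)) x)) \<le> C / real (Suc n) * norm x"
    using rg.decay by blast
  interpret L: decaying_map "(*\<^sub>V) T" M "Suc (2 * m)" C
    by unfold_locales (use assms(2) C in auto)
  define P where "P = CBlinfun L.P"
  have P: "P *\<^sub>V x = L.P x" for x unfolding P_def by (rule CBlinfun_apply[OF L.P_clin])
  have diff: "(cblinfun_power T n - P) *\<^sub>V x = ((*\<^sub>V) T ^^ n) x - L.P x" for n x
    by (simp add: minus_cblinfun.rep_eq cblinfun_power_apply P)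
  have S: "(cblinfun_id - T) *\<^sub>V x = pb.S x" for x
    by (simp add: minus_cblinfun.rep_eq cblinfun_id.rep_eq pb.S_def)
  have range: "cblinfun_range (cblinfun_id - T) = range pb.S"
    by (simp add: cblinfun_range_def S)
  have Z: "Z = pb.Z" by (simp add: Z_def pb.Z_def range)
  have Fix: "Fix T = {x. T *\<^sub>V x = x}"
    by (simp add: Fix_def cblinfun_kernel_def S pb.S_eq_0_iff)
  have "direct_sum_decomposition (Fix T) Z"
    unfolding direct_sum_decomposition_def
  proof (intro conjI)
    show "csubspace (Fix T)"
      by (auto simp: Fix csubspace_def pb.T_zero pb.T_add pb.T_scaleC)
    show "csubspace Z" by (simp add: Z pb.csubspace_Z)
    show "{u + v | u v. u \<in> Fix T \<and> v \<in> Z} = UNIV"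
    proof -
      have "x = L.P x + (x - L.P x)" for x by simp
      then show ?thesis using L.P_fixed L.P_compl unfolding Fix Z by blast
    qed
    show "Fix T \<inter> Z = {0}"
      using pb.fixed_in_Z pb.T_zero pb.csubspace_Z by (auto simp: Fix Z csubspace_def)
  qed
  moreover have "is_projection_along P (Fix T) Z"
    unfolding is_projection_along_def
  proof (intro conjI)
    show "P o\<^sub>C\<^sub>L P = P"
      by (rule cblinfun_eqI) (simp add: cblinfun_compose.rep_eq P L.P_P)
    show "cblinfun_range P = Fix T"
      unfolding cblinfun_range_def Fix using L.P_fixed L.P_fixed_eq by (auto simp: P image_iff) metis
    show "cblinfun_kernel P = Z"
      by (simp add: cblinfun_kernel_def Z P L.P_eq_0_iff)
  qed
  moreover have "(\<lambda>n. norm (cblinfun_power T n *\<^sub>V x - P *\<^sub>V x)) \<longlonglongrightarrow> 0" for x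
    using tendsto_norm_zero[OF LIM_zero[OF L.pow_tendsto_P[of x]]] by (simp add: cblinfun_power_apply P)
  moreover have "\<exists>C>0. \<exists>r\<in>{0..<1}. \<forall>n. norm (cblinfun_power T n - P) \<le> C * r ^ n"
    if "closed (cblinfun_range (cblinfun_id - T))"
  proof -
    obtain B r where B: "B > 0" "r \<in> {0..<1}"
      "\<And>n x. norm (((*\<^sub>V) T ^^ n) x - L.P x) \<le> B * r ^ n * norm x"
      using L.closed_range_exponential \<open>closed _\<close> unfolding range by blast
    then have "norm (cblinfun_power T n - P) \<le> B * r ^ n" for n
      by (intro cblinfun_norm_bound) (auto simp: diff)
    then show ?thesis using B(1,2) by blast
  qed
  moreover have "arbitrarily_slow (\<lambda>n. cblinfun_power T n - P)"
    "weakly_arbitrarily_slow (\<lambda>n. cblinfun_power T n - P)"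
    if ncl: "\<not> closed (cblinfun_range (cblinfun_id - T))"
  proof -
    show "arbitrarily_slow (\<lambda>n. cblinfun_power T n - P)"
      unfolding arbitrarily_slow_def diff using L.slow[OF ncl[unfolded range]] by blast
    show "weakly_arbitrarily_slow (\<lambda>n. cblinfun_power T n - P)"
      unfolding weakly_arbitrarily_slow_def diff
    proof (intro allI impI)
      fix r :: "nat \<Rightarrow> real" assume "(\<forall>n. 0 \<le> r n) \<and> r \<longlonglongrightarrow> 0"
      then obtain x \<phi> where \<phi>: "bounded_clinear \<phi>" "\<And>n. r n \<le> Re (\<phi> (((*\<^sub>V) T ^^ n) x - L.P x))"
        using L.weakly_slow[OF ncl[unfolded range]] by blast
      then show "\<exists>x \<phi>. \<forall>n. r n \<le> Re (\<phi> *\<^sub>V (((*\<^sub>V) T ^^ n) x - L.P x))"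
        by (intro exI[of _ x] exI[of _ "CBlinfun \<phi>"]) (simp add: CBlinfun_apply)
    qed
  qed
  moreover have "superpolynomially_fast (\<lambda>n. cblinfun_power T n - P) x" if x: "x \<in> L.smooth_vectors" for x
    unfolding superpolynomially_fast_def diff
  proof (intro allI impI)
    fix k :: nat
    obtain B where "\<And>n. norm (((*\<^sub>V) T ^^ n) x - L.P x) \<le> B / real (Suc n) ^ Suc k"
      using L.smooth_vectors_fast[OF x, of "Suc k"] by blast
    then show "(\<lambda>n. norm (((*\<^sub>V) T ^^ n) x - L.P x)) \<in> o(\<lambda>n. 1 / real n ^ k)"
      by (intro inverse_power_bound_imp_smallo) auto
  qed
  ultimately show ?thesis
    using L.csubspace_smooth_vectors L.closure_smooth_vectors by blast
qed

end
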